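(* Let $n\ge1$ and $t>0$. There is no measurable function $W:\mathbb H_{\mathbb C}\to[0,\infty)$ which is left $\mathbb H$-invariant (i.e. $W(hg)=W(g)$ for all $h\in\mathbb H$, $g\in\mathbb H_{\mathbb C}$) and satisfies $$\int_{\mathbb H}|f(h)|^2\,dh=\int_{\mathbb H_{\mathbb C}}|\mathcal H_tf(g)|^2\,W(g)\,dg\quad\text{for all }f\in L^2(\mathbb H).$$ In other words, the image of $\mathcal H_t$ is not a weighted Bergman space with a non-negative left $\mathbb H$-invariant weight.
   Context: $\mathbb H=\mathbb{R}^n\times\mathbb{R}^n\times\mathbb{R}$ with product $(\mathbf x,\mathbf u,\xi)(\mathbf x',\mathbf u',\xi')=(\mathbf x+\mathbf x',\mathbf u+\mathbf u',\xi+\xi'+\frac12(\mathbf x\cdot\mathbf u'-\mathbf u\cdot\mathbf x'))$ and Haar measure $dh=d\mathbf x\,d\mathbf u\,d\xi$; its complexification $\mathbb H_{\mathbb C}=\mathbb{C}^n\times\mathbb{C}^n\times\mathbb{C}$ has the same product formula ($\mathbf a\cdot\mathbf b=\sum a_jb_j$ complex bilinear), Lebesgue measure $dg$, and contains $\mathbb H$ as its real points. Heat kernel: $k_t(\mathbf x,\mathbf u,\xi)=c_n\int_{\mathbb{R}}e^{-i\lambda\xi}e^{-t\lambda^2}\big(\frac{\lambda}{\sinh t\lambda}\big)^n e^{-\frac{\lambda}{4}\coth(t\lambda)(\mathbf x\cdot\mathbf x+\mathbf u\cdot\mathbf u)}d\lambda$ with $c_n=(4\pi)^{-n}$; its holomorphic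 extension $k_t^\sim$ to $\mathbb H_{\mathbb C}$ is given by the same formula with $(\mathbf z,\mathbf w,\zeta)$ in place of $(\mathbf x,\mathbf u,\xi)$. The heat kernel transform is $\mathcal H_tf(g)=\int_{\mathbb H}f(h)\,k_t^\sim(h^{-1}g)\,dh$ for $f\in L^2(\mathbb H)$, $g\in\mathbb H_{\mathbb C}$. *)

theory Defs
  imports "HOL-Analysis.Analysis"
begin

type_synonym 'n heis = "(real^'n) \<times> (real^'n) \<times> real"
type_synonym 'n heisC = "(complex^'n) \<times> (complex^'n) \<times> complex"

definition cdot :: "complex^'n \<Rightarrow> complex^'n \<Rightarrow> complex" where
  "cdot a b = (\<Sum>j\<in>UNIV. a $ j * b $ j)"

definition heisC_mult :: "'n::finite heisC \<Rightarrow> 'n heisC \<Rightarrow> 'n heisC" where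
  "heisC_mult g g' = (case g of (z, w, \<zeta>) \<Rightarrow> case g' of (z', w', \<zeta>') \<Rightarrow>
     (z + z', w + w', \<zeta> + \<zeta>' + (1/2) * (cdot z w' - cdot w z')))"

definition heis_emb :: "'n::finite heis \<Rightarrow> 'n heisC" where
  "heis_emb h = (case h of (x, u, \<xi>) \<Rightarrow>
     (vec_lambda (\<lambda>j. complex_of_real (x $ j)), vec_lambda (\<lambda>j. complex_of_real (u $ j)),
      complex_of_real \<xi>))"

definition heis_inv :: "'n::finite heis \<Rightarrow> 'n heis" where
  "heis_inv h = (case h of (x, u, \<xi>) \<Rightarrow> (-x, -u, -\<xi>))"

text \<open>Holomorphic extension of the heat kernel k_t to H_C (c_n = (4 pi)^(-n)).\<close>
definition heat_kernelC :: "real \<Rightarrow> 'n::finite heisC \<Rightarrow> complex" where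
  "heat_kernelC t g = (case g of (z, w, \<zeta>) \<Rightarrow>
     complex_of_real ((4 * pi) powi (- int CARD('n))) *
     (LINT l|lborel.
        exp (- \<i> * complex_of_real l * \<zeta>) * complex_of_real (exp (- t * l\<^sup>2)) *
        complex_of_real ((l / sinh (t * l)) ^ CARD('n)) *
        exp (- complex_of_real (l / 4 * (cosh (t * l) / sinh (t * l))) *
             (cdot z z + cdot w w))))"

definition heat_transform :: "real \<Rightarrow> ('n::finite heis \<Rightarrow> complex) \<Rightarrow> 'n heisC \<Rightarrow> complex" where
  "heat_transform t f g =
     (LINT h|lebesgue. f h * heat_kernelC t (heisC_mult (heis_emb (heis_inv h)) g))"

definition L2_heis :: "('n::finite heis \<Rightarrow> complex) set" where
  "L2_heis = {f. f \<in> borel_measurable lebesgue \<and> integrable lebesgue (\<lambda>h. (cmod (f h))\<^sup>2)}"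

end

theory Submission
  imports Defs "HOL-Probability.Characteristic_Functions"
begin

text \<open>
  Every point of the complexified group is uniquely \<open>h k\<close> with \<open>h\<close> real and
  \<open>k = (i y, i v, i \<eta>)\<close>, and a left-invariant weight depends on \<open>k\<close> only. For the Gaussian
  \<open>f = exp (- a (|x|\<^sup>2 + |u|\<^sup>2) - b \<xi>\<^sup>2)\<close>, Plancherel in the central variable turns the squared norm of the
  transform of \<open>f\<close> over the fibre of \<open>k\<close> into
  \<open>\<integral> p(l) exp (2 l \<eta> + \<theta>(l) (|y|\<^sup>2 + |v|\<^sup>2)) dl\<close>, where \<open>p\<close> and \<open>\<theta>\<close> are explicit and, uniformly in \<open>a\<close>,
  \<open>|l| \<le> \<theta>(l) \<le> |l| + 1 / t\<close>. So frequency \<open>l\<close> of one Gaussian is dominated by the frequencies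
  \<open>\<plusminus>(|l| + 1 / t)\<close> of another: with a non-negative weight, the squared norm of the Gaussian with parameters
  \<open>(a, 1 / 2)\<close> is at most a constant times \<open>a\<close> to the power \<open>- 2 n\<close>, the fixed Gaussian \<open>(1, 1)\<close> being
  the majorant. As that squared norm is a constant times \<open>a\<close> to the power \<open>- n\<close>, this fails for large \<open>a\<close>.
\<close>

section \<open>Gaussian integrals\<close>

text \<open>Nothing is known of the weight except that it is non-negative and invariant, so
  integrals against it can be evaluated only through the supposed isometry, and an inequality valid
  on every single fibre has to do the work. The two powers of \<open>a\<close> have different
  origins: for large \<open>a\<close> the Gaussian is nearly a point mass of size
  \<open>a^(- n)\<close> in \<open>(x, u)\<close>, and the smoothing transform sees little more than
  this mass, which is squared; the squared \<open>L^2\<close> norm of the Gaussian itself is only of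
  order \<open>a^(- n)\<close>. Equal frequencies cannot be compared, because theta depends on
  \<open>a\<close> and \<open>|y|^2 + |v|^2\<close> is unbounded. Raising the frequency by
  \<open>1 / t\<close> suffices since \<open>1 <= coth s <= 1 + 1 / s\<close> for
  \<open>s > 0\<close>. The price is a loss in the density \<open>p\<close> with exponent linear in
  the new frequency \<open>m\<close>. The different central parameters \<open>1 / 2\<close> and
  \<open>1\<close> pay for it: they leave a factor \<open>exp (- m^2 / 2)\<close> to spare.\<close>

lemma has_bochner_integral_gaussian_char:
  fixes s :: real
  shows "has_bochner_integral lborel (\<lambda>x. exp (of_real (- x\<^sup>2 / 2) + \<i> * of_real (s * x)))
           (of_real (sqrt (2 * pi)) * exp (of_real (- s\<^sup>2 / 2)))"
proof -
  have eq: "std_normal_density x *\<^sub>R iexp (s * x) =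
      of_real (1 / sqrt (2 * pi)) * exp (of_real (- x\<^sup>2 / 2) + \<i> * of_real (s * x))" for x
    by (simp only: exp_add) (simp add: std_normal_density_def scaleR_conv_of_real exp_of_real[symmetric])
  have int: "integrable lborel (\<lambda>x. std_normal_density x *\<^sub>R iexp (s * x))"
    by (rule Bochner_Integration.integrable_bound[OF integrable_normal_density[of 1 0]]) auto
  have "(LBINT x. std_normal_density x *\<^sub>R iexp (s * x)) = of_real (exp (- s\<^sup>2 / 2))"
    using fun_cong[OF char_std_normal_distribution, of s]
    by (simp add: char_def integral_density)
  with int have "has_bochner_integral lborel (\<lambda>x. std_normal_density x *\<^sub>R iexp (s * x))
      (of_real (exp (- s\<^sup>2 / 2)))"
    by (simp add: has_bochner_integral_iff)
  then have "has_bochner_integral lborel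
      (\<lambda>x. of_real (sqrt (2 * pi)) * (std_normal_density x *\<^sub>R iexp (s * x)))
      (of_real (sqrt (2 * pi)) * of_real (exp (- s\<^sup>2 / 2)))"
    by (rule has_bochner_integral_mult_right[rotated])
  then show ?thesis
    unfolding eq by (simp add: exp_of_real[symmetric])
qed

text \<open>Only the real part of \<open>c\<close> is absorbed, by a real shift of the variable; the
  imaginary part stays behind as the frequency of the characteristic function, so complex
  \<open>c\<close> is reached without moving the contour.\<close>

lemma has_bochner_integral_gaussian:
  fixes a :: real and c :: complex
  assumes a: "a > 0"
  shows "has_bochner_integral lborel (\<lambda>x. exp (- of_real a * (of_real x)\<^sup>2 + c * of_real x))
           (of_real (sqrt (pi / a)) * exp (c\<^sup>2 / (4 * of_real a)))"
proof -
  define k where "k = 1 / sqrt (2 * a)"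
  define p q where "p = Re c" and "q = Im c"
  have c: "c = of_real p + \<i> * of_real q"
    by (simp add: p_def q_def complex_eq[symmetric])
  have k: "k > 0" "k\<^sup>2 = 1 / (2 * a)"
    using a by (auto simp: k_def power_divide)
  define C where "C = exp ((of_real p)\<^sup>2 / (4 * of_real a) + \<i> * of_real (q * p / (2 * a)))"
  have "exp (- of_real a * (of_real (p / (2 * a) + k * y))\<^sup>2 + c * of_real (p / (2 * a) + k * y)) =
      C * exp (of_real (- y\<^sup>2 / 2) + \<i> * of_real ((q * k) * y))" for y
  proof -
    have ak: "a * k\<^sup>2 = 1 / 2" using a k by simp
    have R: "- a * (p / (2 * a) + k * y)\<^sup>2 + p * (p / (2 * a) + k * y) = p\<^sup>2 / (4 * a) - (a * k\<^sup>2) * y\<^sup>2"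
      using a by (simp add: field_simps power2_eq_square)
    have I: "q * (p / (2 * a) + k * y) = q * p / (2 * a) + q * k * y"
      by (simp add: algebra_simps)
    have "- of_real a * (of_real (p / (2 * a) + k * y))\<^sup>2 + c * of_real (p / (2 * a) + k * y) =
       complex_of_real (- a * (p / (2 * a) + k * y)\<^sup>2 + p * (p / (2 * a) + k * y)) +
       \<i> * of_real (q * (p / (2 * a) + k * y))"
      unfolding c by (simp add: algebra_simps add_divide_distrib)
    also have "\<dots> = of_real (p\<^sup>2 / (4 * a) - y\<^sup>2 / 2) + \<i> * of_real (q * p / (2 * a) + q * k * y)"
      unfolding R I ak by simp
    also have "\<dots> = ((of_real p)\<^sup>2 / (4 * of_real a) + \<i> * of_real (q * p / (2 * a))) +
        (of_real (- y\<^sup>2 / 2) + \<i> * of_real ((q * k) * y))"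
      by (simp add: algebra_simps)
    finally show ?thesis
      unfolding C_def exp_add[symmetric] by simp
  qed
  moreover have "has_bochner_integral lborel (\<lambda>y. C * exp (of_real (- y\<^sup>2 / 2) + \<i> * of_real ((q * k) * y)))
      (C * (of_real (sqrt (2 * pi)) * exp (of_real (- (q * k)\<^sup>2 / 2))))"
    by (rule has_bochner_integral_mult_right[OF has_bochner_integral_gaussian_char])
  moreover have "C * (of_real (sqrt (2 * pi)) * exp (of_real (- (q * k)\<^sup>2 / 2))) =
      (of_real (sqrt (pi / a)) * exp (c\<^sup>2 / (4 * of_real a))) /\<^sub>R \<bar>k\<bar>"
  proof -
    have 1: "sqrt (2 * pi) = sqrt (pi / a) / \<bar>k\<bar>"
      using a by (simp add: k_def real_sqrt_divide real_sqrt_mult)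
    have 2: "c\<^sup>2 / (4 * of_real a) = (of_real p)\<^sup>2 / (4 * of_real a) + \<i> * of_real (q * p / (2 * a)) + of_real (- (q * k)\<^sup>2 / 2)"
      using a by (simp add: c power_mult_distrib k(2) flip: of_real_power)
         (simp add: field_simps power2_eq_square)
    show ?thesis
      unfolding 2 exp_add C_def 1 by (simp add: scaleR_conv_of_real field_simps)
  qed
  ultimately show ?thesis
    using k(1) by (subst lborel_has_bochner_integral_real_affine_iff[of k _ _ "p / (2 * a)"]) auto
qed

lemma has_bochner_integral_lborel_prod_Basis:
  fixes f :: "'a::euclidean_space \<Rightarrow> real \<Rightarrow> complex"
  assumes f: "\<And>b. b \<in> Basis \<Longrightarrow> has_bochner_integral lborel (f b) (I b)"
  shows "has_bochner_integral lborel (\<lambda>x::'a. \<Prod>b\<in>Basis. f b (x \<bullet> b)) (\<Prod>b\<in>Basis. I b)"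
proof -
  interpret product_sigma_finite "\<lambda>_::'a. lborel :: real measure" ..
  have [measurable]: "f b \<in> borel_measurable borel" if "b \<in> Basis" for b
    using f[OF that] by (auto simp: has_bochner_integral_iff)
  have fi: "\<And>b. b \<in> Basis \<Longrightarrow> integrable lborel (f b)" "\<And>b. b \<in> Basis \<Longrightarrow> integral\<^sup>L lborel (f b) = I b"
    using f by (auto simp: has_bochner_integral_iff)
  have *: "(\<Prod>b\<in>Basis. f b ((\<Sum>i\<in>Basis. x i *\<^sub>R i) \<bullet> b)) = (\<Prod>b\<in>Basis. f b (x b))" for x
    by (intro prod.cong) auto
  show ?thesis
    unfolding has_bochner_integral_iff
  proof
    show "integrable lborel (\<lambda>x::'a. \<Prod>b\<in>Basis. f b (x \<bullet> b))"
      by (subst lborel_eq, subst integrable_distr_eq)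
        (auto simp: * intro!: product_integrable_prod fi)
    show "(LBINT x::'a. \<Prod>b\<in>Basis. f b (x \<bullet> b)) = prod I Basis"
      by (subst lborel_eq, subst integral_distr)
        (auto simp: * product_integral_prod fi intro!: prod.cong)
  qed
qed

lemma prod_Basis_vec:
  fixes h :: "real^'n::finite \<Rightarrow> 'b::comm_monoid_mult"
  shows "(\<Prod>b\<in>(Basis :: (real^'n) set). h b) = (\<Prod>j\<in>UNIV. h (axis j 1))"
proof -
  have "inj (\<lambda>j::'n. axis j (1::real))"
    by (auto simp: inj_def axis_eq_axis)
  moreover have "(Basis :: (real^'n) set) = range (\<lambda>j. axis j 1)"
    by (auto simp: Basis_vec_def)
  ultimately show ?thesis
    using prod.reindex[of "\<lambda>j::'n. axis j (1::real)" UNIV h] by (metis (no_types, lifting) comp_apply prod.cong)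
qed

lemma has_bochner_integral_gaussian_vec:
  fixes a :: real and c :: "complex^'n::finite"
  assumes a: "a > 0"
  shows "has_bochner_integral lborel
      (\<lambda>x::real^'n. exp (- of_real (a * (x \<bullet> x)) + (\<Sum>j\<in>UNIV. c $ j * of_real (x $ j))))
           (of_real (sqrt (pi / a) ^ CARD('n)) * exp (cdot c c / (4 * of_real a)))"
proof -
  define f where "f b y = exp (- of_real a * (of_real y)\<^sup>2 + (\<Sum>j\<in>UNIV. c $ j * of_real (b $ j)) * of_real y)"
    for b :: "real^'n" and y :: real
  define I where "I b = of_real (sqrt (pi / a)) * exp ((\<Sum>j\<in>UNIV. c $ j * of_real (b $ j))\<^sup>2 / (4 * of_real a))"
    for b :: "real^'n"
  have "has_bochner_integral lborel (\<lambda>x::real^'n. \<Prod>b\<in>Basis. f b (x \<bullet> b)) (\<Prod>b\<in>Basis. I b)"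
    unfolding f_def I_def
    by (rule has_bochner_integral_lborel_prod_Basis[OF has_bochner_integral_gaussian[OF a]])
  moreover have ax: "(\<Sum>j\<in>UNIV. c $ j * of_real (axis i 1 $ j)) = c $ i" for i
    by (simp add: axis_def if_distrib cong: if_cong)
  have "(\<Prod>b\<in>Basis. f b (x \<bullet> b)) = exp (- of_real (a * (x \<bullet> x)) + (\<Sum>j\<in>UNIV. c $ j * of_real (x $ j)))" for x
    unfolding prod_Basis_vec f_def ax
    by (simp add: exp_sum[symmetric] inner_axis sum.distrib sum_distrib_left inner_vec_def[of x x] power2_eq_square sum_negf sum_subtractf)
  moreover have "(\<Prod>b\<in>Basis. I b) = of_real (sqrt (pi / a) ^ CARD('n)) * exp (cdot c c / (4 * of_real a))"
    unfolding prod_Basis_vec I_def ax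
    by (simp add: prod.distrib exp_sum[symmetric] cdot_def sum_divide_distrib power2_eq_square)
  ultimately show ?thesis by simp
qed

section \<open>Plancherel on the real line for rapidly decaying functions\<close>

lemma integrable_gaussian:
  fixes a c :: real
  assumes "a > 0"
  shows "integrable lborel (\<lambda>x. exp (- a * x\<^sup>2 + c * x))"
proof -
  have "integrable lborel (\<lambda>x. norm (exp (- complex_of_real a * (of_real x)\<^sup>2 + of_real c * of_real x)))"
    using has_bochner_integral_gaussian[OF assms, of "of_real c"]
    by (intro integrable_norm) (auto simp: has_bochner_integral_iff)
  then show ?thesis
    by (simp add: norm_exp_eq_Re flip: of_real_power)
qed

text \<open>Domination by a tensor product justifies the exchanges of Bochner integrals
  below.\<close>

lemma integrable_lborel_pair_bound:
  fixes F :: "'a::euclidean_space \<times> 'b::euclidean_space \<Rightarrow> complex"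
  assumes [measurable]: "F \<in> borel_measurable borel"
    and f: "integrable lborel f" and g: "integrable lborel g"
    and le: "\<And>x y. norm (F (x, y)) \<le> f x * g y"
  shows "integrable (lborel \<Otimes>\<^sub>M lborel) F"
proof -
  have [measurable]: "f \<in> borel_measurable borel" "g \<in> borel_measurable borel"
    using f g by auto
  have m: "(\<lambda>(x, y). f x * g y) \<in> borel_measurable (lborel \<Otimes>\<^sub>M lborel)"
    by measurable
  have "integrable (lborel \<Otimes>\<^sub>M lborel) (\<lambda>(x, y). f x * g y)"
  proof (rule lborel_pair.Fubini_integrable[OF m])
    show "integrable lborel (\<lambda>x. LBINT y. norm (case (x, y) of (x, y) \<Rightarrow> f x * g y))"
      using f g by (simp add: abs_mult)
    show "AE x in lborel. integrable lborel (\<lambda>y. case (x, y) of (x, y) \<Rightarrow> f x * g y)"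
      using g by simp
  qed
  moreover have "F \<in> borel_measurable (lborel \<Otimes>\<^sub>M lborel)"
    by (simp add: lborel_prod)
  ultimately show ?thesis
  proof (rule Bochner_Integration.integrable_bound)
    show "AE p in lborel \<Otimes>\<^sub>M lborel. norm (F p) \<le> norm (case p of (x, y) \<Rightarrow> f x * g y)"
      by (intro AE_I2) (auto intro: order_trans[OF le abs_ge_self] split: prod.splits)
  qed
qed

lemma borel_measurable_lborel_integral_fst:
  fixes F :: "'a::euclidean_space \<times> 'b::euclidean_space \<Rightarrow> complex"
  assumes "F \<in> borel_measurable borel"
  shows "(\<lambda>x. LBINT y. F (x, y)) \<in> borel_measurable borel"
proof -
  have "F \<in> borel_measurable (lborel \<Otimes>\<^sub>M lborel)"
    using assms by (simp add: lborel_prod)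
  then have "(\<lambda>x. LBINT y. F (x, y)) \<in> borel_measurable lborel"
    by measurable
  then show ?thesis by simp
qed

lemma borel_measurable_cnj [measurable]: "cnj \<in> borel_measurable borel"
  by (intro borel_measurable_continuous_onI continuous_intros)

text \<open>The outer integral is damped by a Gaussian of growing width, so that all exchanges
  converge absolutely. One side then converges monotonically, without prior knowledge that the
  transform is square integrable; on the other side the damping becomes convolution with an
  approximate identity, which converges wherever \<open>G\<close> is continuous. Continuity is asked
  for almost everywhere, since the function it is applied to has a spurious value at
  \<open>0\<close>.\<close>

lemma plancherel_real_line:
  fixes G :: "real \<Rightarrow> complex"
  assumes [measurable]: "G \<in> borel_measurable borel"
    and c: "c > 0" and bnd: "\<And>l. cmod (G l) \<le> C * exp (- c * l\<^sup>2)"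
    and cont: "AE l in lborel. isCont G l"
  shows "(\<integral>\<^sup>+ x. ennreal ((cmod (LBINT l. exp (- \<i> * of_real l * of_real x) * G l))\<^sup>2) \<partial>lborel) =
         ennreal (2 * pi) * (\<integral>\<^sup>+ l. ennreal ((cmod (G l))\<^sup>2) \<partial>lborel)"
proof -
  define Gh where "Gh x = (LBINT l. exp (- \<i> * of_real l * of_real x) * G l)" for x :: real
  have "0 \<le> C" using bnd[of 0] by (simp, smt (verit) norm_ge_zero)
  have gb: "cmod (G l) \<le> C" for l
    using bnd[of l] c \<open>0 \<le> C\<close> mult_left_le[of "exp (- c * l\<^sup>2)" C] by force
  have intG: "integrable lborel G"
  proof (rule Bochner_Integration.integrable_bound)
    show "integrable lborel (\<lambda>l. C * exp (- c * l\<^sup>2 + 0 * l))"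
      using integrable_gaussian[OF c, of 0] by simp
    show "AE l in lborel. norm (G l) \<le> norm (C * exp (- c * l\<^sup>2 + 0 * l))"
      using bnd \<open>0 \<le> C\<close> by (simp add: abs_mult)
  qed simp
  define K where "K = (LBINT l. cmod (G l))"
  have intE: "integrable lborel (\<lambda>l. exp (- \<i> * of_real l * of_real x) * G l)" for x
    by (rule Bochner_Integration.integrable_bound[OF intG]) (auto simp: norm_mult)
  have Gh_le: "cmod (Gh x) \<le> K" for x
  proof -
    have "cmod (Gh x) \<le> (LBINT l. cmod (exp (- \<i> * of_real l * of_real x) * G l))"
      unfolding Gh_def by (rule integral_norm_bound)
    then show ?thesis by (simp add: norm_mult K_def)
  qed
  have Gh_meas[measurable]: "Gh \<in> borel_measurable borel"
    unfolding Gh_def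
    using borel_measurable_lborel_integral_fst[of "\<lambda>(x, l). exp (- \<i> * of_real l * of_real x) * G l"]
    by (simp add: borel_prod[symmetric])
  \<comment> \<open>With \<open>r = Suc k\<close> the Fourier transform of \<open>e k\<close> is
    \<open>2 r sqrt pi exp (- (r l)^2)\<close>, of total mass \<open>2 pi\<close>: this is the
    origin of the constant in the statement.\<close>
  define e where "e k x = exp (- (x / (2 * real (Suc k)))\<^sup>2)" for k :: nat and x :: real
  have [measurable]: "e k \<in> borel_measurable borel" for k
    unfolding e_def by measurable
  have e_eq: "e k x = exp (- (1 / (4 * (real (Suc k))\<^sup>2)) * x\<^sup>2 + 0 * x)" for k x
    by (simp add: e_def power_divide power_mult_distrib del: of_nat_Suc)
  have e_int: "integrable lborel (e k)" for k
    unfolding e_eq by (rule integrable_gaussian) simp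
  have e_pos: "e k x > 0" for k x by (simp add: e_def)
  have mono: "(\<lambda>k. \<integral>\<^sup>+ x. ennreal ((cmod (Gh x))\<^sup>2 * e k x) \<partial>lborel) \<longlonglongrightarrow>
      (\<integral>\<^sup>+ x. ennreal ((cmod (Gh x))\<^sup>2) \<partial>lborel)"
  proof (rule nn_integral_LIMSEQ)
    show "incseq (\<lambda>k x. ennreal ((cmod (Gh x))\<^sup>2 * e k x))"
    proof (intro incseq_SucI le_funI ennreal_leI mult_left_mono)
      fix k x
      have "(x / (2 * real (Suc (Suc k))))\<^sup>2 \<le> (x / (2 * real (Suc k)))\<^sup>2"
        unfolding power_divide by (intro divide_left_mono) (auto intro!: power_mono mult_pos_pos)
      then show "e k x \<le> e (Suc k) x"
        by (simp add: e_def)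
    qed simp
    fix x
    have "(\<lambda>k. x / 2 * (1 / real (Suc k))) \<longlonglongrightarrow> x / 2 * 0"
      by (intro tendsto_mult tendsto_const LIMSEQ_Suc[OF lim_1_over_n])
    then have "(\<lambda>k. e k x) \<longlonglongrightarrow> exp (- (0::real)\<^sup>2)"
      unfolding e_def by (intro tendsto_intros) (simp add: field_simps)
    then have "(\<lambda>k. (cmod (Gh x))\<^sup>2 * e k x) \<longlonglongrightarrow> (cmod (Gh x))\<^sup>2 * 1"
      by (intro tendsto_mult) simp_all
    then show "(\<lambda>k. ennreal ((cmod (Gh x))\<^sup>2 * e k x)) \<longlonglongrightarrow> ennreal ((cmod (Gh x))\<^sup>2)"
      by (intro tendsto_ennrealI) simp
  qed (use e_pos in \<open>auto simp: less_imp_le\<close>)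
  \<comment> \<open>The convolution of \<open>cnj G\<close> with that approximate identity, rescaled
    by \<open>m = l + s / r\<close>: now \<open>k\<close> occurs only in the argument of
    \<open>G\<close>, and the Gaussian in \<open>s\<close> can dominate.\<close>
  define H where "H k l = (LBINT s. cnj (G (l + s / real (Suc k))) * of_real (2 * sqrt pi * exp (- s\<^sup>2)))"
    for k :: nat and l
  have exp2: "integrable lborel (\<lambda>s::real. exp (- s\<^sup>2))"
    using integrable_gaussian[of 1 0] by simp
  have inner: "(LBINT x. of_real (e k x) * exp (- \<i> * of_real l * of_real x) * cnj (Gh x)) = H k l" for k l
  proof -
    define \<Phi> where "\<Phi> x m = of_real (e k x) * exp (- \<i> * of_real (l - m) * of_real x) * cnj (G m)" for x m :: real
    have "case_prod \<Phi> \<in> borel_measurable borel"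
      unfolding \<Phi>_def borel_prod[symmetric] by measurable
    then have "integrable (lborel \<Otimes>\<^sub>M lborel) (case_prod \<Phi>)"
      by (rule integrable_lborel_pair_bound[OF _ e_int integrable_norm[OF intG]])
        (auto simp: \<Phi>_def norm_mult less_imp_le[OF e_pos])
    from lborel_pair.Fubini_integral[OF this]
    have "(LBINT x. LBINT m. \<Phi> x m) = (LBINT m. LBINT x. \<Phi> x m)" ..
    moreover have "(LBINT m. \<Phi> x m) = of_real (e k x) * exp (- \<i> * of_real l * of_real x) * cnj (Gh x)" for x
    proof -
      have "cnj (Gh x) = (LBINT m. cnj (exp (- \<i> * of_real m * of_real x) * G m))"
        unfolding Gh_def by (simp only: Bochner_Integration.integral_cnj)
      also have "\<dots> = (LBINT m. exp (\<i> * of_real m * of_real x) * cnj (G m))"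
        by (simp add: exp_cnj)
      finally have "of_real (e k x) * exp (- \<i> * of_real l * of_real x) * cnj (Gh x) =
         (LBINT m. (of_real (e k x) * exp (- \<i> * of_real l * of_real x)) * (exp (\<i> * of_real m * of_real x) * cnj (G m)))"
        by simp
      also have "\<dots> = (LBINT m. \<Phi> x m)"
        unfolding \<Phi>_def
        by (intro Bochner_Integration.integral_cong)
           (simp_all add: algebra_simps exp_add[symmetric] flip: exp_add)
      finally show ?thesis ..
    qed
    moreover have "(LBINT m. LBINT x. \<Phi> x m) = H k l"
    proof -
      define r where "r = real (Suc k)"
      have r: "r > 0" by (simp add: r_def)
      have *: "(LBINT x. \<Phi> x m) = cnj (G m) * of_real (2 * r * sqrt pi * exp (- (r * (m - l))\<^sup>2))" for m
      proof -
        have "has_bochner_integral lborel (\<lambda>x. exp (- of_real (1 / (4 * r\<^sup>2)) * (of_real x)\<^sup>2 + (- \<i> * of_real (l - m)) * of_real x))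
           (of_real (sqrt (pi / (1 / (4 * r\<^sup>2)))) * exp ((- \<i> * of_real (l - m))\<^sup>2 / (4 * of_real (1 / (4 * r\<^sup>2)))))"
          by (rule has_bochner_integral_gaussian) (use r in simp)
        moreover have "sqrt (pi / (1 / (4 * r\<^sup>2))) = 2 * r * sqrt pi"
          using r by (simp add: real_sqrt_mult)
        moreover have "exp ((- \<i> * complex_of_real (l - m))\<^sup>2 / (4 * of_real (1 / (4 * r\<^sup>2)))) = of_real (exp (- (r * (m - l))\<^sup>2))"
          using r unfolding exp_of_real[symmetric]
          by (intro arg_cong[where f = exp]) (simp add: power_mult_distrib, simp add: algebra_simps power2_eq_square)
        ultimately have "(LBINT x. exp (- of_real (1 / (4 * r\<^sup>2)) * (of_real x)\<^sup>2 + (- \<i> * of_real (l - m)) * of_real x)) =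
            complex_of_real (2 * r * sqrt pi * exp (- (r * (m - l))\<^sup>2))"
          by (simp add: has_bochner_integral_iff)
        moreover have "\<Phi> x m = cnj (G m) * exp (- of_real (1 / (4 * r\<^sup>2)) * (of_real x)\<^sup>2 + (- \<i> * of_real (l - m)) * of_real x)" for x
          unfolding \<Phi>_def e_eq r_def[symmetric]
          by (simp add: exp_of_real[symmetric] mult.assoc flip: exp_add)
        ultimately show ?thesis by simp
      qed
      have "(LBINT m. LBINT x. \<Phi> x m) = (LBINT m. cnj (G m) * of_real (2 * r * sqrt pi * exp (- (r * (m - l))\<^sup>2)))"
        unfolding * ..
      also have "\<dots> = \<bar>1 / r\<bar> *\<^sub>R (LBINT s. cnj (G (l + 1 / r * s)) * of_real (2 * r * sqrt pi * exp (- (r * (l + 1 / r * s - l))\<^sup>2)))"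
        by (rule lborel_integral_real_affine) (use r in simp)
      also have "\<dots> = H k l"
        using r unfolding H_def r_def[symmetric]
        by (subst integral_scaleR_right[symmetric])
           (auto intro!: Bochner_Integration.integral_cong simp: scaleR_conv_of_real field_simps)
      finally show ?thesis .
    qed
    ultimately show ?thesis by simp
  qed
  \<comment> \<open>One factor of the squared modulus is expanded as an integral over
    \<open>l\<close>; the integral over \<open>x\<close> then produces \<open>H k l\<close>.\<close>
  have outer: "(LBINT x. complex_of_real ((cmod (Gh x))\<^sup>2 * e k x)) = (LBINT l. G l * H k l)" for k
  proof -
    define \<Phi> where "\<Phi> x l = of_real (e k x) * exp (- \<i> * of_real l * of_real x) * cnj (Gh x) * G l" for x l :: real
    have "integrable (lborel \<Otimes>\<^sub>M lborel) (case_prod \<Phi>)"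
    proof (rule integrable_lborel_pair_bound)
      show "integrable lborel (\<lambda>x. e k x * K)" using e_int by simp
      show "integrable lborel (\<lambda>x. norm (G x))" using intG by simp
      show "case_prod \<Phi> \<in> borel_measurable borel"
        unfolding \<Phi>_def borel_prod[symmetric] by measurable
      show "norm (case_prod \<Phi> (x, y)) \<le> e k x * K * norm (G y)" for x y
        unfolding \<Phi>_def using Gh_le[of x] less_imp_le[OF e_pos[of k x]]
        by (auto simp: norm_mult intro!: mult_right_mono mult_left_mono)
    qed
    from lborel_pair.Fubini_integral[OF this]
    have "(LBINT x. LBINT l. \<Phi> x l) = (LBINT l. LBINT x. \<Phi> x l)" ..
    moreover have "(LBINT l. \<Phi> x l) = complex_of_real ((cmod (Gh x))\<^sup>2 * e k x)" for x
    proof -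
      have "(LBINT l. \<Phi> x l) = (LBINT l. (of_real (e k x) * cnj (Gh x)) * (exp (- \<i> * of_real l * of_real x) * G l))"
        unfolding \<Phi>_def by (simp add: mult_ac)
      also have "\<dots> = of_real (e k x) * cnj (Gh x) * Gh x"
        unfolding Gh_def by (rule integral_mult_right_zero)
      finally show ?thesis
        unfolding of_real_mult complex_norm_square by (simp add: mult_ac)
    qed
    moreover have "(LBINT x. \<Phi> x l) = G l * H k l" for l
      unfolding \<Phi>_def inner[symmetric] by simp
    ultimately show ?thesis by simp
  qed
  have Hmeas[measurable]: "H k \<in> borel_measurable borel" for k
    unfolding H_def
    using borel_measurable_lborel_integral_fst[of "\<lambda>(l, s). cnj (G (l + s / real (Suc k))) * of_real (2 * sqrt pi * exp (- s\<^sup>2))"]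
    by (simp add: borel_prod[symmetric])
  have Hlim: "(\<lambda>k. H k l) \<longlonglongrightarrow> 2 * of_real pi * cnj (G l)" if "isCont G l" for l
  proof -
    have "(\<lambda>k. H k l) \<longlonglongrightarrow> (LBINT s. cnj (G l) * of_real (2 * sqrt pi * exp (- s\<^sup>2)))"
      unfolding H_def
    proof (rule integral_dominated_convergence)
      show "integrable lborel (\<lambda>s. C * (2 * sqrt pi * exp (- s\<^sup>2)))"
        using exp2 by simp
      show "AE s in lborel. (\<lambda>k. cnj (G (l + s / real (Suc k))) * of_real (2 * sqrt pi * exp (- s\<^sup>2)))
          \<longlonglongrightarrow> cnj (G l) * of_real (2 * sqrt pi * exp (- s\<^sup>2))"
      proof (intro AE_I2 tendsto_mult tendsto_const tendsto_cnj)
        fix s :: real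
        have "(\<lambda>k. l + s * (1 / real (Suc k))) \<longlonglongrightarrow> l + s * 0"
          by (intro tendsto_intros LIMSEQ_Suc[OF lim_1_over_n])
        then have "(\<lambda>k. l + s / real (Suc k)) \<longlonglongrightarrow> l" by simp
        with that show "(\<lambda>k. G (l + s / real (Suc k))) \<longlonglongrightarrow> G l"
          by (rule isCont_tendsto_compose)
      qed
      show "AE s in lborel. norm (cnj (G (l + s / real (Suc k))) * of_real (2 * sqrt pi * exp (- s\<^sup>2)))
           \<le> C * (2 * sqrt pi * exp (- s\<^sup>2))" for k
        using gb by (auto simp: norm_mult intro!: mult_right_mono)
    qed measurable
    also have "(LBINT s. cnj (G l) * of_real (2 * sqrt pi * exp (- s\<^sup>2))) = 2 * of_real pi * cnj (G l)"
    proof -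
      have "(LBINT s. complex_of_real (exp (- s\<^sup>2))) = of_real (sqrt pi)"
        using has_bochner_integral_gaussian[of 1 0] by (simp add: has_bochner_integral_iff del: integral_complex_of_real flip: exp_of_real)
      then have "(LBINT s. exp (- s\<^sup>2)) = sqrt pi"
        unfolding integral_complex_of_real using of_real_eq_iff by blast
      moreover have "2 * sqrt pi * sqrt pi = 2 * pi" by simp
      ultimately have "(LBINT s. 2 * sqrt pi * exp (- s\<^sup>2)) = 2 * pi" by simp
      then have I: "(LBINT s. complex_of_real (2 * sqrt pi * exp (- s\<^sup>2))) = of_real (2 * pi)"
        by (simp only: integral_complex_of_real)
      show ?thesis
        by (simp only: integral_mult_right_zero I) simp
    qed
    finally show ?thesis .
  qed
  \<comment> \<open>Uniform in \<open>k\<close> and \<open>l\<close>, so a constant times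
    \<open>cmod (G l)\<close> dominates in the final limit.\<close>
  have Hbd: "cmod (H k l) \<le> C * (2 * sqrt pi * (LBINT s. exp (- s\<^sup>2)))" for k l
  proof -
    have "cmod (H k l) \<le> (LBINT s. C * (2 * sqrt pi * exp (- s\<^sup>2)))"
      unfolding H_def using gb exp2
      by (intro order_trans[OF integral_norm_bound] integral_mono')
         (auto simp: norm_mult intro!: mult_right_mono mult_nonneg_nonneg \<open>0 \<le> C\<close>)
    then show ?thesis by simp
  qed
  have "(\<lambda>k. LBINT l. G l * H k l) \<longlonglongrightarrow> (LBINT l. G l * (2 * of_real pi * cnj (G l)))"
  proof (rule integral_dominated_convergence)
    show "integrable lborel (\<lambda>l. cmod (G l) * (C * (2 * sqrt pi * (LBINT s. exp (- s\<^sup>2)))))"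
      using intG by simp
    show "AE l in lborel. (\<lambda>k. G l * H k l) \<longlonglongrightarrow> G l * (2 * of_real pi * cnj (G l))"
      using cont by eventually_elim (intro tendsto_mult tendsto_const Hlim)
    show "AE l in lborel. norm (G l * H k l) \<le> cmod (G l) * (C * (2 * sqrt pi * (LBINT s. exp (- s\<^sup>2))))" for k
      using Hbd by (auto simp: norm_mult intro!: mult_left_mono)
  qed measurable
  also have "(\<lambda>l. G l * (2 * of_real pi * cnj (G l))) = (\<lambda>l. of_real (2 * pi * (cmod (G l))\<^sup>2))"
    unfolding of_real_mult complex_norm_square by (simp add: mult_ac)
  finally have "(\<lambda>k. complex_of_real (LBINT x. (cmod (Gh x))\<^sup>2 * e k x)) \<longlonglongrightarrow> of_real (LBINT l. 2 * pi * (cmod (G l))\<^sup>2)"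
    unfolding outer[symmetric] integral_complex_of_real .
  then have "(\<lambda>k. LBINT x. (cmod (Gh x))\<^sup>2 * e k x) \<longlonglongrightarrow> (LBINT l. 2 * pi * (cmod (G l))\<^sup>2)"
    by (rule tendsto_of_real_iff[THEN iffD1])
  then have "(\<lambda>k. ennreal (LBINT x. (cmod (Gh x))\<^sup>2 * e k x)) \<longlonglongrightarrow> ennreal (LBINT l. 2 * pi * (cmod (G l))\<^sup>2)"
    by (rule tendsto_ennrealI)
  moreover have "ennreal (LBINT x. (cmod (Gh x))\<^sup>2 * e k x) = (\<integral>\<^sup>+ x. ennreal ((cmod (Gh x))\<^sup>2 * e k x) \<partial>lborel)" for k
  proof (rule nn_integral_eq_integral[symmetric])
    show "integrable lborel (\<lambda>x. (cmod (Gh x))\<^sup>2 * e k x)"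
    proof (rule Bochner_Integration.integrable_bound[OF integrable_mult_right[OF e_int, of "K\<^sup>2" k]])
      show "AE x in lborel. norm ((cmod (Gh x))\<^sup>2 * e k x) \<le> norm (K\<^sup>2 * e k x)"
        using Gh_le by (auto simp: abs_mult intro!: mult_right_mono power_mono)
    qed measurable
    show "AE x in lborel. 0 \<le> (cmod (Gh x))\<^sup>2 * e k x" using e_pos by (simp add: less_imp_le)
  qed
  moreover have "ennreal (LBINT l. 2 * pi * (cmod (G l))\<^sup>2) = (\<integral>\<^sup>+ l. ennreal (2 * pi * (cmod (G l))\<^sup>2) \<partial>lborel)"
  proof (rule nn_integral_eq_integral[symmetric])
    have "integrable lborel (\<lambda>l. (cmod (G l))\<^sup>2)"
    proof (rule Bochner_Integration.integrable_bound[OF integrable_mult_right[OF integrable_norm[OF intG], of C]])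
      show "AE l in lborel. norm ((cmod (G l))\<^sup>2) \<le> norm (C * cmod (G l))"
        using gb \<open>0 \<le> C\<close> by (auto simp: power2_eq_square abs_mult intro!: mult_right_mono)
    qed measurable
    then show "integrable lborel (\<lambda>l. 2 * pi * (cmod (G l))\<^sup>2)" by simp
  qed simp
  ultimately have "(\<integral>\<^sup>+ x. ennreal ((cmod (Gh x))\<^sup>2) \<partial>lborel) = (\<integral>\<^sup>+ l. ennreal (2 * pi * (cmod (G l))\<^sup>2) \<partial>lborel)"
    using LIMSEQ_unique[OF mono] by simp
  then show ?thesis
    unfolding Gh_def by (simp add: ennreal_mult nn_integral_cmult)
qed

section \<open>The coefficients of the heat kernel\<close>

text \<open>The heat kernel at frequency \<open>l\<close> is \<open>exp (- t l\<^sup>2) (hk_amp t l)\<close> to the power \<open>n\<close> times the Gaussian of rate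
  \<open>hk_rate t l\<close>. Both are \<open>0\<close> instead of their limits at \<open>l = 0\<close>, because of division by zero.\<close>

definition hk_rate :: "real \<Rightarrow> real \<Rightarrow> real" where
  "hk_rate t l = l / 4 * (cosh (t * l) / sinh (t * l))"

definition hk_amp :: "real \<Rightarrow> real \<Rightarrow> real" where
  "hk_amp t l = l / sinh (t * l)"

definition heis_gauss :: "real \<Rightarrow> real \<Rightarrow> 'n::finite heis \<Rightarrow> complex" where
  "heis_gauss a b = (\<lambda>(x, u, \<xi>). of_real (exp (- a * (x \<bullet> x + u \<bullet> u) - b * \<xi>\<^sup>2)))"

text \<open>The twisted convolution at frequency \<open>l\<close> of the Gaussian of rate \<open>a\<close> with the heat kernel is again a Gaussian,
  of rate \<open>conv_rate t a l\<close>.\<close>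

definition conv_rate :: "real \<Rightarrow> real \<Rightarrow> real \<Rightarrow> real" where
  "conv_rate t a l = (a * hk_rate t l + l\<^sup>2 / 16) / (a + hk_rate t l)"

text \<open>The factors come from the heat kernel, from the Fourier transform of the central
  Gaussian, and from \<open>2 n\<close> one-dimensional Gaussian integrals of rate
  \<open>a + hk_rate t l\<close>. The constant \<open>(4 pi)^(- n)\<close> is kept outside; the type
  argument carries the dimension.\<close>

definition conv_amp :: "'n::finite itself \<Rightarrow> real \<Rightarrow> real \<Rightarrow> real \<Rightarrow> real \<Rightarrow> real" where
  "conv_amp _ t a b l = exp (- t * l\<^sup>2 - l\<^sup>2 / (4 * b)) * hk_amp t l ^ CARD('n) *
     sqrt (pi / b) * (pi / (a + hk_rate t l)) ^ CARD('n)"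

lemma borel_measurable_hk [measurable]:
  "hk_rate t \<in> borel_measurable borel" "hk_amp t \<in> borel_measurable borel"
proof -
  have [measurable]: "(\<lambda>l::real. sinh (t * l)) \<in> borel_measurable borel" "(\<lambda>l::real. cosh (t * l)) \<in> borel_measurable borel"
    by (intro borel_measurable_continuous_onI continuous_intros)+
  show "hk_rate t \<in> borel_measurable borel" "hk_amp t \<in> borel_measurable borel"
    unfolding hk_rate_def[abs_def] hk_amp_def[abs_def] by measurable
qed

lemma borel_measurable_vec_nth [measurable]: "(\<lambda>x::real^'n::finite. x $ j) \<in> borel_measurable borel"
  by (intro borel_measurable_continuous_onI continuous_intros)

lemma hk_rate_minus [simp]: "hk_rate t (- l) = hk_rate t l"
  by (simp add: hk_rate_def)

lemma hk_amp_minus [simp]: "hk_amp t (- l) = hk_amp t l"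
  by (simp add: hk_amp_def)

lemma sinh_ge_self: "x \<ge> 0 \<Longrightarrow> x \<le> sinh (x::real)"
proof -
  assume x: "x \<ge> 0"
  have "\<exists>y. sinh x - x = sinh 0 - 0 + y \<and> y \<ge> 0"
  proof (cases "x = 0")
    case False
    with x have "0 < x" by simp
    have "\<exists>z>0. z < x \<and> (sinh x - x) - (sinh 0 - 0) = (x - 0) * (cosh z - 1)"
      by (rule MVT2[OF \<open>0 < x\<close>]) (auto intro!: derivative_eq_intros)
    then obtain z where "sinh x - x = x * (cosh z - 1)" by auto
    moreover have "x * (cosh z - 1) \<ge> 0"
      using x cosh_real_ge_1[of z] by simp
    ultimately show ?thesis by auto
  qed auto
  then show ?thesis by auto
qed

lemma sinh_le_self_cosh: "x \<ge> 0 \<Longrightarrow> sinh (x::real) \<le> x * cosh x"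
proof -
  assume x: "x \<ge> 0"
  show ?thesis
  proof (cases "x = 0")
    case False
    with x have "0 < x" by simp
    have "\<exists>z>0. z < x \<and> sinh x - sinh 0 = (x - 0) * cosh z"
      by (rule MVT2[OF \<open>0 < x\<close>]) (auto intro!: derivative_eq_intros)
    then obtain z where z: "z > 0" "z < x" "sinh x = x * cosh z" by auto
    then have "cosh z \<le> cosh x" using cosh_real_nonneg_le_iff[of z x] by auto
    then show ?thesis using z x by (simp add: mult_left_mono)
  qed auto
qed

context
  fixes t :: real
  assumes t: "t > 0"
begin

text \<open>With \<open>s = t l > 0\<close> these are \<open>1 <= coth s <= 1 + 1 / s\<close> and
  \<open>s coth s >= 1\<close>; evenness gives negative \<open>l\<close>. The third bound takes over
  near \<open>l = 0\<close>, where the first degenerates.\<close>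

lemma hk_rate_bounds:
  assumes "l \<noteq> 0"
  shows "\<bar>l\<bar> \<le> 4 * hk_rate t l" "4 * hk_rate t l \<le> \<bar>l\<bar> + 1 / t" "1 / (4 * t) \<le> hk_rate t l" "hk_rate t l > 0"
proof -
  have main: "l \<le> 4 * hk_rate t l \<and> 4 * hk_rate t l \<le> l + 1 / t \<and> 1 / (4 * t) \<le> hk_rate t l" if l: "l > 0" for l
  proof -
    have tl: "t * l > 0" using t l by simp
    then have sp: "sinh (t * l) > 0" by simp
    have "sinh (t * l) \<le> cosh (t * l)" by (simp add: sinh_le_cosh_real)
    then have 1: "l \<le> 4 * hk_rate t l"
      using sp l by (simp add: hk_rate_def field_simps)
    have "cosh (t * l) - sinh (t * l) = exp (- (t * l))"
      by (rule cosh_minus_sinh)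
    also have "\<dots> \<le> 1" using tl by simp
    finally have "cosh (t * l) \<le> sinh (t * l) + 1" by simp
    then have "l * cosh (t * l) \<le> l * (sinh (t * l) + 1)"
      using l by (intro mult_left_mono) auto
    moreover have "l \<le> sinh (t * l) / t"
      using sinh_ge_self[of "t * l"] tl t by (simp add: field_simps)
    ultimately have "l * cosh (t * l) \<le> (l + 1 / t) * sinh (t * l)"
      by (simp add: algebra_simps)
    then have 2: "4 * hk_rate t l \<le> l + 1 / t"
      using sp by (simp add: hk_rate_def pos_divide_le_eq)
    have "sinh (t * l) \<le> t * l * cosh (t * l)" using sinh_le_self_cosh[of "t * l"] tl by simp
    then have 3: "1 / (4 * t) \<le> hk_rate t l"
      using sp t by (simp add: hk_rate_def field_simps)
    show ?thesis using 1 2 3 by blast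
  qed
  from main[of l] main[of "- l"] assms
  show "\<bar>l\<bar> \<le> 4 * hk_rate t l" "4 * hk_rate t l \<le> \<bar>l\<bar> + 1 / t" "1 / (4 * t) \<le> hk_rate t l"
    by (cases "l > 0"; simp)+
  with t show "hk_rate t l > 0"
    by (metis divide_pos_pos mult_pos_pos order_less_le_trans zero_less_numeral zero_less_one)
qed

lemma hk_rate_nonneg: "hk_rate t l \<ge> 0"
  using hk_rate_bounds(4)[of l] by (cases "l = 0") (auto simp: hk_rate_def[of t 0])

text \<open>The lower bound loses a factor whose exponent is only linear in \<open>l\<close>, which
  a Gaussian surplus can later absorb.\<close>

lemma hk_amp_bounds:
  assumes "l \<noteq> 0"
  shows "hk_amp t l > 0" "hk_amp t l \<le> 1 / t" "2 * \<bar>l\<bar> * exp (- t * \<bar>l\<bar>) \<le> hk_amp t l"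
proof -
  have main: "hk_amp t l > 0 \<and> hk_amp t l \<le> 1 / t \<and> 2 * l * exp (- t * l) \<le> hk_amp t l" if l: "l > 0" for l
  proof -
    have tl: "t * l > 0" using t l by simp
    then have sp: "sinh (t * l) > 0" by simp
    have 2: "hk_amp t l \<le> 1 / t"
      using sinh_ge_self[of "t * l"] tl t sp by (simp add: hk_amp_def field_simps)
    have "2 * sinh (t * l) \<le> exp (t * l)"
      by (simp add: sinh_def exp_minus)
    then have "2 * sinh (t * l) * exp (- t * l) \<le> 1"
      using mult_right_mono[of "2 * sinh (t * l)" "exp (t * l)" "exp (- t * l)"] by (simp add: exp_add[symmetric])
    then have "l * (2 * sinh (t * l) * exp (- t * l)) \<le> l * 1" using l by (intro mult_left_mono) auto
    then have 3: "2 * l * exp (- t * l) \<le> hk_amp t l"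
      using sp by (simp add: hk_amp_def field_simps)
    show ?thesis using 2 3 l sp by (simp add: hk_amp_def)
  qed
  from main[of l] main[of "- l"] assms
  show "hk_amp t l > 0" "hk_amp t l \<le> 1 / t" "2 * \<bar>l\<bar> * exp (- t * \<bar>l\<bar>) \<le> hk_amp t l"
    by (cases "l > 0"; simp)+
qed

lemma hk_amp_abs_le: "\<bar>hk_amp t l\<bar> \<le> 1 / t"
  using hk_amp_bounds[of l] t by (cases "l = 0") (auto simp: hk_amp_def[of t 0])

end

section \<open>Gaussian factors of the integrand of the transform\<close>

lemma has_bochner_integral_pair_mult:
  fixes f :: "'a::euclidean_space \<Rightarrow> complex" and g :: "'b::euclidean_space \<Rightarrow> complex"
  assumes f: "has_bochner_integral lborel f I" and g: "has_bochner_integral lborel g J"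
  shows "has_bochner_integral lborel (\<lambda>(x, y). f x * g y) (I * J)"
proof -
  have fi: "integrable lborel f" "integral\<^sup>L lborel f = I" and gi: "integrable lborel g" "integral\<^sup>L lborel g = J"
    using f g by (auto simp: has_bochner_integral_iff)
  have [measurable]: "f \<in> borel_measurable borel" "g \<in> borel_measurable borel"
    using fi gi by auto
  have "(\<lambda>(x, y). f x * g y) \<in> borel_measurable borel"
    unfolding borel_prod[symmetric] by measurable
  then have int: "integrable (lborel \<Otimes>\<^sub>M lborel) (\<lambda>(x, y). f x * g y)"
    by (rule integrable_lborel_pair_bound[OF _ integrable_norm[OF fi(1)] integrable_norm[OF gi(1)]])
       (simp add: norm_mult)
  have "(\<integral>p. (case p of (x, y) \<Rightarrow> f x * g y) \<partial>(lborel \<Otimes>\<^sub>M lborel)) = I * J"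
    using lborel_pair.integral_fst[OF int] fi gi by simp
  with int show ?thesis
    by (simp add: has_bochner_integral_iff lborel_prod)
qed

lemma cdot_lin:
  "cdot (a *s z + b *s w) (a *s z + b *s w) = a\<^sup>2 * cdot z z + 2 * a * b * cdot z w + b\<^sup>2 * cdot w w"
  by (simp add: cdot_def sum_distrib_left sum.distrib[symmetric] power2_eq_square algebra_simps)

definition cvec :: "real^'n::finite \<Rightarrow> complex^'n" where
  "cvec x = (\<chi> j. of_real (x $ j))"

text \<open>The \<open>x\<close>-part of the integrand of the transform at frequency
  \<open>l\<close>. The symplectic form is antisymmetric, so the \<open>u\<close>-part is the same
  function with \<open>(w, - z)\<close> in place of \<open>(z, w)\<close>.\<close>

definition gauss_factor :: "real \<Rightarrow> real \<Rightarrow> complex^'n::finite \<Rightarrow> complex^'n \<Rightarrow> real \<Rightarrow> real^'n \<Rightarrow> complex" where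
  "gauss_factor t a z w l x = exp (- of_real (a * (x \<bullet> x)) - of_real (hk_rate t l) * cdot (z - cvec x) (z - cvec x) +
     \<i> * of_real l / 2 * cdot (cvec x) w)"

lemma gauss_factor_measurable [measurable]:
  "(\<lambda>(x, l). gauss_factor t a z w l x) \<in> borel_measurable (borel \<Otimes>\<^sub>M borel)"
  unfolding gauss_factor_def cdot_def cvec_def vector_minus_component vec_lambda_beta
  by measurable

lemma has_bochner_integral_gauss_factor:
  fixes z w :: "complex^'n::finite"
  assumes "t > 0" "a > 0"
  shows "has_bochner_integral lborel (gauss_factor t a z w l)
    (of_real (sqrt (pi / (a + hk_rate t l)) ^ CARD('n)) *
     exp (- of_real (hk_rate t l) * cdot z z +
          (4 * (of_real (hk_rate t l))\<^sup>2 * cdot z z + 2 * \<i> * of_real (hk_rate t l * l) * cdot z w - (of_real l)\<^sup>2 / 4 * cdot w w) /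
            (4 * of_real (a + hk_rate t l))))"
proof -
  define g where "g = hk_rate t l"
  \<comment> \<open>The coefficient of the term linear in \<open>x\<close>: the first summand comes
    from the square, the second from the symplectic form.\<close>
  define v where "v = (2 * of_real g) *s z + (\<i> * of_real l / 2) *s w"
  have pos: "a + g > 0" using assms hk_rate_nonneg[of t l] by (simp add: g_def)
  have "has_bochner_integral lborel
     (\<lambda>x::real^'n. exp (- of_real g * cdot z z) * exp (- of_real ((a + g) * (x \<bullet> x)) + (\<Sum>j\<in>UNIV. v $ j * of_real (x $ j))))
     (exp (- of_real g * cdot z z) * (of_real (sqrt (pi / (a + g)) ^ CARD('n)) * exp (cdot v v / (4 * of_real (a + g)))))"
    by (intro has_bochner_integral_mult_right has_bochner_integral_gaussian_vec pos)
  moreover have "exp (- of_real g * cdot z z) * exp (- of_real ((a + g) * (x \<bullet> x)) + (\<Sum>j\<in>UNIV. v $ j * of_real (x $ j)))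
      = gauss_factor t a z w l x" for x
    unfolding gauss_factor_def g_def[symmetric] exp_add[symmetric] v_def cdot_def cvec_def inner_vec_def
    by (intro arg_cong[where f = exp])
       (simp add: sum_distrib_left sum.distrib[symmetric] sum_negf[symmetric] sum_subtractf[symmetric] algebra_simps)
  moreover have "cdot v v = 4 * (of_real g)\<^sup>2 * cdot z z + 2 * \<i> * of_real (g * l) * cdot z w - (of_real l)\<^sup>2 / 4 * cdot w w"
    unfolding v_def cdot_lin by (simp add: power_mult_distrib power_divide)
  ultimately have "has_bochner_integral lborel (gauss_factor t a z w l)
     (exp (- of_real g * cdot z z) * (of_real (sqrt (pi / (a + g)) ^ CARD('n)) *
      exp ((4 * (of_real g)\<^sup>2 * cdot z z + 2 * \<i> * of_real (g * l) * cdot z w - (of_real l)\<^sup>2 / 4 * cdot w w) /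
       (4 * of_real (a + g)))))"
    by simp
  then show ?thesis
    unfolding exp_add g_def by (simp only: mult.left_commute mult.assoc)
qed

text \<open>Serves the exchange of integrals in the transform, where the growth in \<open>l\<close>
  must be beaten by \<open>exp (- t l^2)\<close>. The danger is a factor of size
  \<open>exp (|l| |x| |Im w| / 2)\<close>; the kernel's own Gaussian, of rate at least
  \<open>|l| / 4\<close>, tames it and leaves the decay from \<open>a\<close> untouched.\<close>

lemma norm_gauss_factor_le:
  fixes z w :: "complex^'n::finite"
  assumes t: "t > 0"
  shows "\<exists>c\<ge>0. \<forall>a l x. l \<noteq> 0 \<longrightarrow> cmod (gauss_factor t a z w l x) \<le> exp (- a * (x \<bullet> x) + (\<bar>l\<bar> + 1 / t) * c)"
proof (intro exI conjI allI impI)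
  let ?c = "\<Sum>j\<in>UNIV. (Im (z $ j))\<^sup>2 / 4 + (Im (w $ j))\<^sup>2 / 4 + \<bar>Re (z $ j)\<bar> * \<bar>Im (w $ j)\<bar> / 2"
  show "0 \<le> ?c" by (intro sum_nonneg) simp
  fix a l :: real and x :: "real^'n"
  assume l: "l \<noteq> 0"
  define g where "g = hk_rate t l"
  note gb = hk_rate_bounds[OF t l, folded g_def]
  \<comment> \<open>One coordinate, with \<open>z = p + i y\<close> and \<open>v\<close> the
    imaginary part of \<open>w\<close>. After \<open>|x| <= |p - x| + |p|\<close>, the product
    \<open>|p - x| |v|\<close> is split by AM-GM so that exactly \<open>|l| / 4\<close> falls on
    \<open>(p - x)^2\<close>.\<close>
  have coord: "- g * ((p - x)\<^sup>2 - y\<^sup>2) - l / 2 * (x * v) \<le> (\<bar>l\<bar> + 1 / t) * (y\<^sup>2 / 4 + v\<^sup>2 / 4 + \<bar>p\<bar> * \<bar>v\<bar> / 2)"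
    for p x y v :: real
  proof -
    have "- l / 2 * (x * v) \<le> \<bar>l\<bar> / 2 * (\<bar>x\<bar> * \<bar>v\<bar>)"
      using abs_ge_self[of "- l / 2 * (x * v)"] by (simp add: abs_mult)
    also have "\<dots> \<le> \<bar>l\<bar> / 2 * ((\<bar>p - x\<bar> + \<bar>p\<bar>) * \<bar>v\<bar>)"
      by (intro mult_left_mono mult_right_mono) auto
    also have "\<dots> \<le> \<bar>l\<bar> / 2 * ((p - x)\<^sup>2 / 2 + v\<^sup>2 / 2 + \<bar>p\<bar> * \<bar>v\<bar>)"
    proof (intro mult_left_mono)
      have "2 * (\<bar>p - x\<bar> * \<bar>v\<bar>) \<le> (p - x)\<^sup>2 + v\<^sup>2"
        using sum_squares_bound[of "\<bar>p - x\<bar>" "\<bar>v\<bar>"] by (simp add: mult_ac)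
      then show "(\<bar>p - x\<bar> + \<bar>p\<bar>) * \<bar>v\<bar> \<le> (p - x)\<^sup>2 / 2 + v\<^sup>2 / 2 + \<bar>p\<bar> * \<bar>v\<bar>"
        by (simp add: algebra_simps)
    qed simp
    finally have 1: "- l / 2 * (x * v) \<le> \<bar>l\<bar> / 4 * (p - x)\<^sup>2 + \<bar>l\<bar> * (v\<^sup>2 / 4 + \<bar>p\<bar> * \<bar>v\<bar> / 2)"
      by (simp add: algebra_simps)
    have 2: "\<bar>l\<bar> / 4 * (p - x)\<^sup>2 \<le> g * (p - x)\<^sup>2" using gb(1) by (intro mult_right_mono) auto
    have 3: "g * y\<^sup>2 \<le> (\<bar>l\<bar> + 1 / t) * (y\<^sup>2 / 4)" using gb(2) mult_right_mono[of "4 * g" "\<bar>l\<bar> + 1 / t" "y\<^sup>2 / 4"] by simp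
    have 4: "\<bar>l\<bar> * (v\<^sup>2 / 4 + \<bar>p\<bar> * \<bar>v\<bar> / 2) \<le> (\<bar>l\<bar> + 1 / t) * (v\<^sup>2 / 4 + \<bar>p\<bar> * \<bar>v\<bar> / 2)"
      using t by (intro mult_right_mono) auto
    have 5: "(\<bar>l\<bar> + 1 / t) * (y\<^sup>2 / 4 + v\<^sup>2 / 4 + \<bar>p\<bar> * \<bar>v\<bar> / 2) =
        (\<bar>l\<bar> + 1 / t) * (y\<^sup>2 / 4) + (\<bar>l\<bar> + 1 / t) * (v\<^sup>2 / 4 + \<bar>p\<bar> * \<bar>v\<bar> / 2)"
      by (simp only: distrib_left add.assoc)
    have 6: "- g * ((p - x)\<^sup>2 - y\<^sup>2) - l / 2 * (x * v) = g * y\<^sup>2 - g * (p - x)\<^sup>2 + - l / 2 * (x * v)"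
      by (simp add: algebra_simps)
    show ?thesis using 1 2 3 4 unfolding 5 6 by linarith
  qed
  have "- of_real (a * (x \<bullet> x)) - of_real g * cdot (z - cvec x) (z - cvec x) + \<i> * of_real l / 2 * cdot (cvec x) w
     = of_real (- a * (x \<bullet> x)) + (\<Sum>j\<in>UNIV. - of_real g * (z $ j - of_real (x $ j))\<^sup>2 + \<i> * of_real l / 2 * (of_real (x $ j) * w $ j))"
    unfolding cdot_def cvec_def by (simp add: sum_distrib_left sum_subtractf power2_eq_square)
  then have "Re (- of_real (a * (x \<bullet> x)) - of_real g * cdot (z - cvec x) (z - cvec x) + \<i> * of_real l / 2 * cdot (cvec x) w)
     = - a * (x \<bullet> x) + (\<Sum>j\<in>UNIV. Re (- of_real g * (z $ j - of_real (x $ j))\<^sup>2 + \<i> * of_real l / 2 * (of_real (x $ j) * w $ j)))"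
    by (simp only: plus_complex.simps Re_complex_of_real Re_sum)
  also have "\<dots> = - a * (x \<bullet> x) + (\<Sum>j\<in>UNIV. - g * ((Re (z $ j) - x $ j)\<^sup>2 - (Im (z $ j))\<^sup>2) - l / 2 * (x $ j * Im (w $ j)))"
    by (intro arg_cong2[where f = "(+)"] sum.cong refl) (simp add: power2_eq_square)
  also have "\<dots> \<le> - a * (x \<bullet> x) + (\<Sum>j\<in>UNIV. (\<bar>l\<bar> + 1 / t) * ((Im (z $ j))\<^sup>2 / 4 + (Im (w $ j))\<^sup>2 / 4 + \<bar>Re (z $ j)\<bar> * \<bar>Im (w $ j)\<bar> / 2))"
    by (intro add_left_mono sum_mono coord)
  also have "\<dots> = - a * (x \<bullet> x) + (\<bar>l\<bar> + 1 / t) * ?c"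
    by (simp add: sum_distrib_left)
  finally show "cmod (gauss_factor t a z w l x) \<le> exp (- a * (x \<bullet> x) + (\<bar>l\<bar> + 1 / t) * ?c)"
    unfolding gauss_factor_def g_def[symmetric] norm_exp_eq_Re by simp
qed

section \<open>The heat kernel transform of a Gaussian\<close>

lemma has_bochner_integral_heis_mult:
  fixes f :: "real^'n::finite \<Rightarrow> complex" and g :: "real^'n \<Rightarrow> complex" and e :: "real \<Rightarrow> complex"
  assumes "has_bochner_integral lborel f I" "has_bochner_integral lborel g J" "has_bochner_integral lborel e L"
  shows "has_bochner_integral lborel (\<lambda>(x, u, \<xi>). f x * (g u * e \<xi>)) (I * (J * L))"
  using has_bochner_integral_pair_mult[OF assms(1) has_bochner_integral_pair_mult[OF assms(2,3)]]
  by (simp add: case_prod_unfold)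

lemma split_mult_right_heis:
  "(\<lambda>h. case h of (x, u, \<xi>) \<Rightarrow> (p::complex) * q x u \<xi>) = (\<lambda>h. p * (case h of (x, u, \<xi>) \<Rightarrow> q x u \<xi>))"
  by (simp add: case_prod_unfold)

lemma has_bochner_integral_heis_gauss:
  assumes a: "a > 0" and b: "b > 0"
  shows "has_bochner_integral lborel (heis_gauss a b :: 'n::finite heis \<Rightarrow> complex)
    (of_real ((pi / a) ^ CARD('n) * sqrt (pi / b)))"
proof -
  have x: "has_bochner_integral lborel (\<lambda>x::real^'n. complex_of_real (exp (- a * (x \<bullet> x)))) (of_real (sqrt (pi / a) ^ CARD('n)))"
    using has_bochner_integral_gaussian_vec[OF a, of "0 :: complex^'n"] by (simp add: exp_of_real[symmetric] cdot_def)
  have e: "has_bochner_integral lborel (\<lambda>\<xi>. complex_of_real (exp (- b * \<xi>\<^sup>2))) (of_real (sqrt (pi / b)))"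
    using has_bochner_integral_gaussian[OF b, of 0] by (simp add: exp_of_real[symmetric])
  have "(heis_gauss a b :: 'n heis \<Rightarrow> complex) =
      (\<lambda>(x, u, \<xi>). of_real (exp (- a * (x \<bullet> x))) * (of_real (exp (- a * (u \<bullet> u))) * of_real (exp (- b * \<xi>\<^sup>2))))"
    unfolding heis_gauss_def of_real_mult[symmetric] exp_add[symmetric] by (simp add: algebra_simps)
  moreover have "complex_of_real (sqrt (pi / a) ^ CARD('n)) * (of_real (sqrt (pi / a) ^ CARD('n)) * of_real (sqrt (pi / b))) =
      of_real ((pi / a) ^ CARD('n) * sqrt (pi / b))"
    using a unfolding of_real_mult[symmetric] mult.assoc[symmetric] power_mult_distrib[symmetric] by simp
  ultimately show ?thesis
    using has_bochner_integral_heis_mult[OF x x e] by metis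
qed

text \<open>At fixed \<open>l\<close> the integral over the group factors into Gaussian integrals in
  \<open>x\<close>, \<open>u\<close> and \<open>\<xi>\<close>. The terms in \<open>cdot z w\<close>
  coming from \<open>x\<close> and from \<open>u\<close> have opposite signs and cancel, so that
  only \<open>cdot z z + cdot w w\<close> survives.\<close>

lemma heat_transform_heis_gauss:
  fixes z w :: "complex^'n::finite" and \<zeta> :: complex
  assumes t: "t > 0" and a: "a > 0" and b: "b > 0"
  shows "heat_transform t (heis_gauss a b) (z, w, \<zeta>) =
    of_real ((4 * pi) powi (- int CARD('n))) *
    (LBINT l. exp (- \<i> * of_real l * \<zeta>) * of_real (conv_amp TYPE('n) t a b l) *
       exp (- of_real (conv_rate t a l) * (cdot z z + cdot w w)))"
proof -
  define P where "P l = exp (- \<i> * of_real l * \<zeta>) * of_real (exp (- t * l\<^sup>2) * hk_amp t l ^ CARD('n))" for l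
  define E where "E l \<xi> = exp (- of_real b * (of_real \<xi>)\<^sup>2 + \<i> * of_real l * of_real \<xi>)" for l \<xi> :: real
  define F where "F h l = (case h of (x, u, \<xi>) \<Rightarrow>
      P l * (gauss_factor t a z w l x * (gauss_factor t a w (- z) l u * E l \<xi>)))" for h :: "'n heis" and l
  define C where "C = complex_of_real ((4 * pi) powi (- int CARD('n)))"
  have [measurable]: "P \<in> borel_measurable borel"
    unfolding P_def by measurable
  have [measurable]: "(\<lambda>(\<xi>, l). E l \<xi>) \<in> borel_measurable (borel \<Otimes>\<^sub>M borel)"
    unfolding E_def by measurable
  have Fm: "case_prod F \<in> borel_measurable borel"
    unfolding F_def borel_prod[symmetric] by measurable
  have integrand: "heis_gauss a b h * heat_kernelC t (heisC_mult (heis_emb (heis_inv h)) (z, w, \<zeta>)) = C * (LBINT l. F h l)" for h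
  proof -
    obtain x u \<xi> where h: "h = (x, u, \<xi>)" by (cases h)
    have cv: "(\<chi> j. complex_of_real ((- y) $ j)) = - cvec y" for y :: "real^'n"
      by (simp add: cvec_def vec_eq_iff)
    have cm: "cdot (- p) q = - cdot p q" for p q :: "complex^'n"
      by (simp add: cdot_def sum_negf)
    have g: "heisC_mult (heis_emb (heis_inv h)) (z, w, \<zeta>) =
        (z - cvec x, w - cvec u, - of_real \<xi> + \<zeta> + (1/2) * (- cdot (cvec x) w + cdot (cvec u) z))"
      unfolding h heisC_mult_def heis_emb_def heis_inv_def prod.case cv cm by simp
    have "heis_gauss a b h * heat_kernelC t (heisC_mult (heis_emb (heis_inv h)) (z, w, \<zeta>)) =
      C * (LBINT l. heis_gauss a b h * (exp (- \<i> * of_real l * (- of_real \<xi> + \<zeta> + (1/2) * (- cdot (cvec x) w + cdot (cvec u) z))) *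
        of_real (exp (- t * l\<^sup>2)) * of_real (hk_amp t l ^ CARD('n)) *
        exp (- of_real (hk_rate t l) * (cdot (z - cvec x) (z - cvec x) + cdot (w - cvec u) (w - cvec u)))))"
      unfolding g heat_kernelC_def prod.case C_def hk_amp_def hk_rate_def integral_mult_right_zero
      by (simp only: mult.left_commute)
    moreover have pw: "heis_gauss a b h * (exp (- \<i> * of_real l * (- of_real \<xi> + \<zeta> + (1/2) * (- cdot (cvec x) w + cdot (cvec u) z))) *
        of_real (exp (- t * l\<^sup>2)) * of_real (hk_amp t l ^ CARD('n)) *
        exp (- of_real (hk_rate t l) * (cdot (z - cvec x) (z - cvec x) + cdot (w - cvec u) (w - cvec u)))) = F h l" for l
    proof -
      define X where "X = - complex_of_real (a * (x \<bullet> x)) - of_real (hk_rate t l) * cdot (z - cvec x) (z - cvec x) + \<i> * of_real l / 2 * cdot (cvec x) w"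
      define U where "U = - complex_of_real (a * (u \<bullet> u)) - of_real (hk_rate t l) * cdot (w - cvec u) (w - cvec u) + \<i> * of_real l / 2 * cdot (cvec u) (- z)"
      define V where "V = - of_real b * (of_real \<xi>)\<^sup>2 + \<i> * of_real l * complex_of_real \<xi>"
      have cm2: "cdot p (- q) = - cdot p q" for p q :: "complex^'n"
        by (simp add: cdot_def sum_negf)
      have eq: "of_real (- a * (x \<bullet> x + u \<bullet> u) - b * \<xi>\<^sup>2) +
         ((- \<i> * of_real l * (- of_real \<xi> + \<zeta> + (1/2) * (- cdot (cvec x) w + cdot (cvec u) z))) +
          (- of_real (hk_rate t l) * (cdot (z - cvec x) (z - cvec x) + cdot (w - cvec u) (w - cvec u)))) =
         - \<i> * of_real l * \<zeta> + (X + (U + V))"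
        unfolding X_def U_def V_def cm2 by (simp add: algebra_simps)
      have gf: "gauss_factor t a z w l x = exp X" "gauss_factor t a w (- z) l u = exp U" "E l \<xi> = exp V"
        by (simp_all only: gauss_factor_def E_def X_def U_def V_def)
      have "F h l = exp (- \<i> * of_real l * \<zeta> + (X + (U + V))) * of_real (exp (- t * l\<^sup>2)) * of_real (hk_amp t l ^ CARD('n))"
        unfolding F_def h prod.case P_def gf exp_add of_real_mult
        by (simp only: mult_ac)
      also note eq[symmetric]
      finally show ?thesis
        unfolding heis_gauss_def h prod.case exp_add exp_of_real[symmetric]
        by (simp only: mult_ac)
    qed
    ultimately show ?thesis by (simp only:)
  qed
  have Fbd: "\<exists>K\<ge>0. \<forall>h l. cmod (F h l) \<le> (K * cmod (heis_gauss a b h)) * exp (- (t / 2) * l\<^sup>2 + 0 * l)"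
  proof -
    obtain c1 where c1: "c1 \<ge> 0" "\<And>l x. l \<noteq> 0 \<Longrightarrow> cmod (gauss_factor t a z w l x) \<le> exp (- a * (x \<bullet> x) + (\<bar>l\<bar> + 1 / t) * c1)"
      using norm_gauss_factor_le[OF t, of z w] by auto
    obtain c2 where c2: "c2 \<ge> 0" "\<And>l u. l \<noteq> 0 \<Longrightarrow> cmod (gauss_factor t a w (- z) l u) \<le> exp (- a * (u \<bullet> u) + (\<bar>l\<bar> + 1 / t) * c2)"
      using norm_gauss_factor_le[OF t, of w "- z"] by auto
    \<comment> \<open>\<open>M\<close> collects the linear growth in \<open>|l|\<close>. Half of
      \<open>exp (- t l^2)\<close> absorbs it through
      \<open>M |l| <= t l^2 / 2 + M^2 / (2 t)\<close>; the other half remains to dominate in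
      \<open>l\<close>.\<close>
    define M where "M = \<bar>Im \<zeta>\<bar> + c1 + c2"
    define K where "K = (1 / t) ^ CARD('n) * exp (M\<^sup>2 / (2 * t) + 1 / t * (c1 + c2))"
    have K0: "K \<ge> 0" using t by (simp add: K_def)
    have "cmod (F (x, u, \<xi>) l) \<le> (K * cmod (heis_gauss a b (x, u, \<xi>))) * exp (- (t / 2) * l\<^sup>2 + 0 * l)"
      for x u :: "real^'n" and \<xi> l
    proof (cases "l = 0")
      \<comment> \<open>\<open>hk_amp t 0\<close> is \<open>0\<close> and the exponent
        \<open>n\<close> is positive, so the integrand vanishes here although its limit does
        not.\<close>
      case True
      then show ?thesis using K0 by (simp add: F_def P_def hk_amp_def power_0_left)
    next
      case False
      have "cmod (F (x, u, \<xi>) l) = exp (l * Im \<zeta>) * (exp (- t * l\<^sup>2) * \<bar>hk_amp t l\<bar> ^ CARD('n)) *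
         (cmod (gauss_factor t a z w l x) * (cmod (gauss_factor t a w (- z) l u) * exp (- b * \<xi>\<^sup>2)))"
        unfolding F_def P_def E_def prod.case norm_mult norm_of_real abs_mult norm_exp_eq_Re power_abs
        by (simp flip: of_real_power)
      also have "\<dots> \<le> exp (\<bar>l\<bar> * \<bar>Im \<zeta>\<bar>) * (exp (- t * l\<^sup>2) * (1 / t) ^ CARD('n)) *
         (exp (- a * (x \<bullet> x) + (\<bar>l\<bar> + 1 / t) * c1) * (exp (- a * (u \<bullet> u) + (\<bar>l\<bar> + 1 / t) * c2) * exp (- b * \<xi>\<^sup>2)))"
        using t hk_amp_abs_le[OF t, of l] abs_ge_self[of "l * Im \<zeta>"]
        by (intro mult_mono power_mono c1(2) c2(2) False) (auto simp: abs_mult)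
      also have "\<dots> = (1 / t) ^ CARD('n) * exp (\<bar>l\<bar> * \<bar>Im \<zeta>\<bar> + (- t * l\<^sup>2) + ((- a * (x \<bullet> x) + (\<bar>l\<bar> + 1 / t) * c1) + ((- a * (u \<bullet> u) + (\<bar>l\<bar> + 1 / t) * c2) + - b * \<xi>\<^sup>2)))"
        unfolding exp_add by (simp only: mult_ac)
      also have "\<dots> \<le> (1 / t) ^ CARD('n) * exp ((M\<^sup>2 / (2 * t) + 1 / t * (c1 + c2)) + ((- a * (x \<bullet> x + u \<bullet> u) - b * \<xi>\<^sup>2) + (- (t / 2) * l\<^sup>2)))"
      proof (intro mult_left_mono exp_le_cancel_iff[THEN iffD2])
        have "0 \<le> (t * \<bar>l\<bar> - M)\<^sup>2 / (2 * t)" using t by simp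
        also have "\<dots> = t / 2 * l\<^sup>2 - M * \<bar>l\<bar> + M\<^sup>2 / (2 * t)"
          using t by (simp add: power2_diff power_mult_distrib field_simps power2_eq_square)
        finally have "M * \<bar>l\<bar> \<le> t / 2 * l\<^sup>2 + M\<^sup>2 / (2 * t)" by simp
        moreover have "\<bar>l\<bar> * \<bar>Im \<zeta>\<bar> + (- t * l\<^sup>2) + ((- a * (x \<bullet> x) + (\<bar>l\<bar> + 1 / t) * c1) + ((- a * (u \<bullet> u) + (\<bar>l\<bar> + 1 / t) * c2) + - b * \<xi>\<^sup>2))
          = M * \<bar>l\<bar> + 1 / t * (c1 + c2) + (- a * (x \<bullet> x + u \<bullet> u) - b * \<xi>\<^sup>2) - (t / 2 * l\<^sup>2 + t / 2 * l\<^sup>2)"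
          unfolding M_def distrib_left distrib_right by simp
        ultimately show "\<bar>l\<bar> * \<bar>Im \<zeta>\<bar> + (- t * l\<^sup>2) + ((- a * (x \<bullet> x) + (\<bar>l\<bar> + 1 / t) * c1) + ((- a * (u \<bullet> u) + (\<bar>l\<bar> + 1 / t) * c2) + - b * \<xi>\<^sup>2))
          \<le> (M\<^sup>2 / (2 * t) + 1 / t * (c1 + c2)) + ((- a * (x \<bullet> x + u \<bullet> u) - b * \<xi>\<^sup>2) + (- (t / 2) * l\<^sup>2))"
          by linarith
      qed (use t in simp)
      also have "\<dots> = (K * cmod (heis_gauss a b (x, u, \<xi>))) * exp (- (t / 2) * l\<^sup>2 + 0 * l)"
        unfolding K_def heis_gauss_def prod.case norm_of_real exp_add by simp
      finally show ?thesis .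
    qed
    with K0 show ?thesis by (intro exI[of _ K]) auto
  qed
  then obtain K where K: "K \<ge> 0" "\<And>h l. cmod (F h l) \<le> (K * cmod (heis_gauss a b h)) * exp (- (t / 2) * l\<^sup>2 + 0 * l)"
    by blast
  have ig: "integrable lborel (heis_gauss a b :: 'n heis \<Rightarrow> complex)"
    using has_bochner_integral_heis_gauss[OF a b, where ?'n = 'n] unfolding has_bochner_integral_iff by blast
  have Fint: "integrable (lborel \<Otimes>\<^sub>M lborel) (case_prod F)"
    using K ig t by (intro integrable_lborel_pair_bound[OF Fm _ integrable_gaussian[of "t / 2" 0], where f = "\<lambda>h. K * cmod (heis_gauss a b h)"])
      auto
  have inner: "(LBINT h. F h l) = exp (- \<i> * of_real l * \<zeta>) * of_real (conv_amp TYPE('n) t a b l) *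
       exp (- of_real (conv_rate t a l) * (cdot z z + cdot w w))" for l
  proof -
    define g where "g = hk_rate t l"
    define D where "D = complex_of_real (a + g)"
    have pos: "a + g > 0" using a hk_rate_nonneg[OF t, of l] by (simp add: g_def)
    then have D: "D \<noteq> 0" unfolding D_def of_real_eq_0_iff by simp
    have cm: "cdot w (- z) = - cdot z w" "cdot (- z) (- z) = cdot z z"
      by (simp_all add: cdot_def sum_negf mult.commute)
    have E: "has_bochner_integral lborel (E l) (of_real (sqrt (pi / b)) * exp ((\<i> * of_real l)\<^sup>2 / (4 * of_real b)))"
      unfolding E_def by (rule has_bochner_integral_gaussian[OF b])
    let ?XA = "- of_real g * cdot z z + (4 * (of_real g)\<^sup>2 * cdot z z + 2 * \<i> * of_real (g * l) * cdot z w - (of_real l)\<^sup>2 / 4 * cdot w w) / (4 * D)"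
    let ?XB = "- of_real g * cdot w w + (4 * (of_real g)\<^sup>2 * cdot w w + 2 * \<i> * of_real (g * l) * cdot w (- z) - (of_real l)\<^sup>2 / 4 * cdot (- z) (- z)) / (4 * D)"
    have "has_bochner_integral lborel (\<lambda>h. F h l)
       (P l * ((of_real (sqrt (pi / (a + g)) ^ CARD('n)) * exp ?XA) * ((of_real (sqrt (pi / (a + g)) ^ CARD('n)) * exp ?XB) *
         (of_real (sqrt (pi / b)) * exp ((\<i> * of_real l)\<^sup>2 / (4 * of_real b))))))"
      unfolding F_def D_def g_def
      by (subst split_mult_right_heis) (intro has_bochner_integral_mult_right has_bochner_integral_heis_mult has_bochner_integral_gauss_factor t a E)
    then have "(LBINT h. F h l) = P l * ((of_real (sqrt (pi / (a + g)) ^ CARD('n)) * exp ?XA) * ((of_real (sqrt (pi / (a + g)) ^ CARD('n)) * exp ?XB) *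
         (of_real (sqrt (pi / b)) * exp ((\<i> * of_real l)\<^sup>2 / (4 * of_real b)))))"
      by (simp add: has_bochner_integral_iff)
    also have "\<dots> = P l * (of_real (sqrt (pi / (a + g)) ^ CARD('n) * sqrt (pi / (a + g)) ^ CARD('n)) * exp (?XA + ?XB) *
         (of_real (sqrt (pi / b)) * exp ((\<i> * of_real l)\<^sup>2 / (4 * of_real b))))"
      unfolding exp_add of_real_mult by (simp only: mult_ac)
    also have "?XA + ?XB = - of_real (conv_rate t a l) * (cdot z z + cdot w w)"
    proof -
      have cr: "complex_of_real (conv_rate t a l) = (of_real a * of_real g + (of_real l)\<^sup>2 / 16) / D"
        unfolding conv_rate_def D_def g_def by simp
      have sp: "- G * Z + V / (4 * D) = (- G * Z * D + V / 4) / D" for G Z V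
        using D by (simp add: field_simps)
      \<comment> \<open>Over the denominator \<open>D\<close> the terms in \<open>g^2\<close>
        cancel, and the terms in \<open>l^2\<close>, which trade \<open>z\<close> for
        \<open>w\<close>, restore the symmetric form.\<close>
      have "(- of_real g * cdot z z * D + (4 * (of_real g)\<^sup>2 * cdot z z + 2 * \<i> * of_real (g * l) * cdot z w - (of_real l)\<^sup>2 / 4 * cdot w w) / 4) +
         (- of_real g * cdot w w * D + (4 * (of_real g)\<^sup>2 * cdot w w + 2 * \<i> * of_real (g * l) * - cdot z w - (of_real l)\<^sup>2 / 4 * cdot z z) / 4)
        = - (of_real a * of_real g + (of_real l)\<^sup>2 / 16) * (cdot z z + cdot w w)"
        by (simp add: D_def field_simps power2_eq_square)
      then show ?thesis
        unfolding cm sp cr add_divide_distrib[symmetric]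
        by (simp only: mult_minus_left times_divide_eq_left minus_divide_left)
    qed
    also have "sqrt (pi / (a + g)) ^ CARD('n) * sqrt (pi / (a + g)) ^ CARD('n) = (pi / (a + g)) ^ CARD('n)"
      using pos by (simp add: power_mult_distrib[symmetric])
    also have "exp ((\<i> * of_real l)\<^sup>2 / (4 * of_real b)) = complex_of_real (exp (- l\<^sup>2 / (4 * b)))"
      unfolding exp_of_real[symmetric] by (simp add: power_mult_distrib)
    also have "P l * (of_real ((pi / (a + g)) ^ CARD('n)) * exp (- of_real (conv_rate t a l) * (cdot z z + cdot w w)) *
         (of_real (sqrt (pi / b)) * complex_of_real (exp (- l\<^sup>2 / (4 * b))))) =
       exp (- \<i> * of_real l * \<zeta>) * of_real (exp (- t * l\<^sup>2 + - l\<^sup>2 / (4 * b)) * hk_amp t l ^ CARD('n) * sqrt (pi / b) * (pi / (a + g)) ^ CARD('n)) *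
       exp (- of_real (conv_rate t a l) * (cdot z z + cdot w w))"
      unfolding P_def exp_add of_real_mult by (simp only: mult_ac)
    also have "- t * l\<^sup>2 + - l\<^sup>2 / (4 * b) = - t * l\<^sup>2 - l\<^sup>2 / (4 * b)" by simp
    finally show ?thesis unfolding conv_amp_def g_def .
  qed
  have "heat_transform t (heis_gauss a b) (z, w, \<zeta>) = (LINT h|lebesgue. C * (LBINT l. F h l))"
    unfolding heat_transform_def integrand ..
  also have "\<dots> = (LBINT h. C * (LBINT l. F h l))"
    using borel_measurable_lborel_integral_fst[OF Fm] by (intro integral_completion) simp
  also have "\<dots> = C * (LBINT l. LBINT h. F h l)"
    unfolding lborel_pair.Fubini_integral[OF Fint] by simp
  finally show ?thesis
    unfolding inner C_def .
qed

section \<open>Polar coordinates and left-invariant weights\<close>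

text \<open>Such a map merely renames coordinates: it matches boxes with boxes of the same side
  lengths, and these determine Lebesgue measure.\<close>

lemma lborel_distr_Basis_iso:
  fixes T :: "'a::euclidean_space \<Rightarrow> 'b::euclidean_space"
  assumes lin: "linear T" and bij: "bij_betw T Basis Basis"
  shows "T \<in> borel_measurable borel" "distr lborel borel T = lborel"
proof -
  show m[measurable]: "T \<in> borel_measurable borel"
    using lin by (intro borel_measurable_continuous_onI linear_continuous_on) (simp add: linear_conv_bounded_linear)
  have TB: "T b \<in> Basis" if "b \<in> Basis" for b using bij that by (auto simp: bij_betw_def)
  have inj: "inj_on T Basis" and img: "T ` Basis = Basis" using bij by (auto simp: bij_betw_def)
  have inn: "T x \<bullet> T b = x \<bullet> b" if b: "b \<in> Basis" for x b
  proof -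
    have "T x = T (\<Sum>c\<in>Basis. (x \<bullet> c) *\<^sub>R c)" by (simp add: euclidean_representation)
    also have "\<dots> = (\<Sum>c\<in>Basis. (x \<bullet> c) *\<^sub>R T c)"
      by (simp add: linear_sum[OF lin] linear_scale[OF lin])
    finally have "T x \<bullet> T b = (\<Sum>c\<in>Basis. (x \<bullet> c) * (T c \<bullet> T b))"
      by (simp add: inner_sum_left)
    also have "\<dots> = (\<Sum>c\<in>Basis. (x \<bullet> c) * (if c = b then 1 else 0))"
      using inj b TB by (intro sum.cong) (auto simp: inner_Basis inj_on_def)
    also have "\<dots> = x \<bullet> b" using b by (simp add: if_distrib cong: if_cong)
    finally show ?thesis .
  qed
  have "lborel = distr lborel borel T"
  proof (rule lborel_eqI)
    fix l u :: 'b assume le: "\<And>b. b \<in> Basis \<Longrightarrow> l \<bullet> b \<le> u \<bullet> b"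
    define S where "S v = (\<Sum>b\<in>Basis. (v \<bullet> T b) *\<^sub>R b)" for v
    have S: "S v \<bullet> b = v \<bullet> T b" if "b \<in> Basis" for v b
      using that by (simp add: S_def)
    have "T -` box l u = box (S l) (S u)"
      unfolding box_def vimage_def by (auto simp: S inn TB) (metis TB inn, metis TB inn, metis (no_types, lifting) img imageE inn, metis (no_types, lifting) img imageE inn)
    then have "emeasure (distr lborel borel T) (box l u) = emeasure lborel (box (S l) (S u))"
      by (simp add: emeasure_distr)
    also have "\<dots> = (\<Prod>b\<in>Basis. (S u - S l) \<bullet> b)"
      using le TB by (intro emeasure_lborel_box) (simp add: S)
    also have "(\<Prod>b\<in>Basis. (S u - S l) \<bullet> b) = (\<Prod>b\<in>Basis. (u - l) \<bullet> T b)"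
      by (intro prod.cong) (auto simp: inner_diff_left S)
    also have "\<dots> = (\<Prod>b\<in>T ` Basis. (u - l) \<bullet> b)"
      using inj by (simp add: prod.reindex)
    finally show "emeasure (distr lborel borel T) (box l u) = (\<Prod>b\<in>Basis. (u - l) \<bullet> b)"
      unfolding img .
  qed simp
  then show "distr lborel borel T = lborel" ..
qed

definition re_im_join :: "'n::finite heis \<times> 'n heis \<Rightarrow> 'n heisC" where
  "re_im_join = (\<lambda>((x, u, \<xi>), (y, v, \<eta>)). (\<chi> j. Complex (x $ j) (y $ j), \<chi> j. Complex (u $ j) (v $ j), Complex \<xi> \<eta>))"

definition heis_imag :: "'n::finite heis \<Rightarrow> 'n heisC" where
  "heis_imag = (\<lambda>(y, v, \<eta>). (\<chi> j. \<i> * of_real (y $ j), \<chi> j. \<i> * of_real (v $ j), \<i> * of_real \<eta>))"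

text \<open>The product of a real \<open>h\<close> with an imaginary \<open>k\<close> has real part
  \<open>h\<close>; its imaginary part is \<open>k\<close> with a central shift from the symplectic
  form. In real coordinates the polar map is thus a shear and preserves volume.\<close>

definition heis_shear :: "'n::finite heis \<times> 'n heis \<Rightarrow> 'n heis \<times> 'n heis" where
  "heis_shear = (\<lambda>((x, u, \<xi>), (y, v, \<eta>)). ((x, u, \<xi>), (y, v, (x \<bullet> v - u \<bullet> y) / 2 + \<eta>)))"

lemma heisC_mult_heis_imag: "heisC_mult (heis_emb h) (heis_imag k) = re_im_join (heis_shear (h, k))"
proof (cases h, cases k)
  fix x u \<xi> y v \<eta> assume "h = (x, u, \<xi>)" "k = (y, v, \<eta>)"
  moreover have "cdot (\<chi> j. of_real (p $ j)) (\<chi> j. \<i> * of_real (q $ j)) = \<i> * of_real (p \<bullet> q)" for p q :: "real^'a"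
    by (simp add: cdot_def inner_vec_def sum_distrib_left mult_ac)
  ultimately show ?thesis
    by (simp add: heisC_mult_def heis_emb_def heis_imag_def re_im_join_def heis_shear_def vec_eq_iff complex_eq_iff)
qed

lemma re_im_join_iso:
  "(re_im_join :: 'n::finite heis \<times> 'n heis \<Rightarrow> 'n heisC) \<in> borel_measurable borel" "distr lborel borel (re_im_join :: 'n::finite heis \<times> 'n heis \<Rightarrow> 'n heisC) = lborel"
proof -
  have lin: "linear (re_im_join :: 'n heis \<times> 'n heis \<Rightarrow> 'n heisC)"
    by (rule linearI) (auto simp: re_im_join_def vec_eq_iff complex_eq_iff)
  have c: "(\<chi> j. Complex (axis i 1 $ j) 0) = axis i 1" "(\<chi> j. Complex 0 (axis i 1 $ j)) = axis i \<i>"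
    "(\<chi> j::'n. Complex 0 0) = 0" for i :: 'n
    by (auto simp: vec_eq_iff axis_def complex_eq_iff)
  have c': "Complex 1 0 = 1" "Complex 0 1 = \<i>" "Complex 0 0 = 0" "(\<chi> j. 0) = (0 :: complex^'n)"
    by (auto simp: vec_eq_iff complex_eq_iff)
  have Br: "(Basis :: (real^'n) set) = range (\<lambda>i. axis i 1)" and
    Bc: "(Basis :: (complex^'n) set) = range (\<lambda>i. axis i 1) \<union> range (\<lambda>i. axis i \<i>)"
    by (auto simp: Basis_vec_def Basis_complex_def)
  have "(re_im_join :: 'n heis \<times> 'n heis \<Rightarrow> 'n heisC) ` Basis = Basis"
    unfolding Basis_prod_def Br Bc Basis_complex_def Basis_real_def
    by (auto simp: image_Un image_image re_im_join_def zero_prod_def c c')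
  moreover have "inj_on (re_im_join :: 'n heis \<times> 'n heis \<Rightarrow> 'n heisC) Basis"
    by (auto simp: inj_on_def re_im_join_def vec_eq_iff)
  ultimately have "bij_betw (re_im_join :: 'n heis \<times> 'n heis \<Rightarrow> 'n heisC) Basis Basis"
    by (simp add: bij_betw_def)
  from lborel_distr_Basis_iso[OF lin this]
  show "(re_im_join :: 'n heis \<times> 'n heis \<Rightarrow> 'n heisC) \<in> borel_measurable borel" "distr lborel borel (re_im_join :: 'n heis \<times> 'n heis \<Rightarrow> 'n heisC) = lborel"
    by auto
qed

lemma nn_integral_lborel_fst:
  fixes F :: "'a::euclidean_space \<times> 'b::euclidean_space \<Rightarrow> ennreal"
  assumes "F \<in> borel_measurable borel"
  shows "(\<integral>\<^sup>+ p. F p \<partial>lborel) = (\<integral>\<^sup>+ x. \<integral>\<^sup>+ y. F (x, y) \<partial>lborel \<partial>lborel)"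
  unfolding lborel_prod[symmetric]
  by (rule lborel.nn_integral_fst[symmetric]) (use assms in \<open>simp add: lborel_prod\<close>)

lemma nn_integral_lborel_snd:
  fixes F :: "'a::euclidean_space \<times> 'b::euclidean_space \<Rightarrow> ennreal"
  assumes "F \<in> borel_measurable borel"
  shows "(\<integral>\<^sup>+ p. F p \<partial>lborel) = (\<integral>\<^sup>+ y. \<integral>\<^sup>+ x. F (x, y) \<partial>lborel \<partial>lborel)"
  unfolding lborel_prod[symmetric]
  by (rule lborel_pair.nn_integral_snd[symmetric]) (use assms in \<open>simp add: lborel_prod\<close>)

lemma nn_integral_lborel_triple:
  fixes G :: "'a::euclidean_space \<times> 'b::euclidean_space \<times> 'c::euclidean_space \<Rightarrow> ennreal"
  assumes G: "G \<in> borel_measurable borel"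
  shows "(\<integral>\<^sup>+ k. G k \<partial>lborel) = (\<integral>\<^sup>+ x. \<integral>\<^sup>+ y. \<integral>\<^sup>+ s. G (x, y, s) \<partial>lborel \<partial>lborel \<partial>lborel)"
proof -
  have "(\<lambda>q. G (x, q)) \<in> borel_measurable borel" for x
    by (rule measurable_compose[OF _ G]) (intro borel_measurable_continuous_onI continuous_intros)
  then show ?thesis
    by (simp add: nn_integral_lborel_fst[OF G] nn_integral_lborel_fst)
qed

lemma heis_shear_measurable [measurable]: "heis_shear \<in> borel_measurable borel"
  unfolding heis_shear_def case_prod_unfold
  by (auto intro!: borel_measurable_continuous_onI continuous_intros)

lemma nn_integral_heis_shear:
  fixes F :: "'n::finite heis \<times> 'n heis \<Rightarrow> ennreal"
  assumes F[measurable]: "F \<in> borel_measurable borel"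
  shows "(\<integral>\<^sup>+ p. F (heis_shear p) \<partial>lborel) = (\<integral>\<^sup>+ p. F p \<partial>lborel)"
proof -
  have "(\<integral>\<^sup>+ k. F (heis_shear (h, k)) \<partial>lborel) = (\<integral>\<^sup>+ k. F (h, k) \<partial>lborel)" for h
  proof -
    obtain x u \<xi> where h: "h = (x, u, \<xi>)" by (cases h)
    have m1: "(\<lambda>k. F (h, k)) \<in> borel_measurable borel" for h
      by (rule measurable_compose[OF _ F]) (intro borel_measurable_continuous_onI continuous_intros)
    have m2: "(\<lambda>k. F (heis_shear (h, k))) \<in> borel_measurable borel"
      by (rule measurable_compose[OF _ measurable_compose[OF heis_shear_measurable F]]) (intro borel_measurable_continuous_onI continuous_intros)
    show ?thesis
      unfolding nn_integral_lborel_triple[OF m1] nn_integral_lborel_triple[OF m2]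
    proof (rule nn_integral_cong, rule nn_integral_cong)
      fix y v
      have m3: "(\<lambda>\<eta>. F (h, (y, v, \<eta>))) \<in> borel_measurable borel"
        by (rule measurable_compose[OF _ F]) (intro borel_measurable_continuous_onI continuous_intros)
      show "(\<integral>\<^sup>+ \<eta>. F (heis_shear (h, (y, v, \<eta>))) \<partial>lborel) = (\<integral>\<^sup>+ \<eta>. F (h, (y, v, \<eta>)) \<partial>lborel)"
        using nn_integral_real_affine[OF m3, of 1 "(x \<bullet> v - u \<bullet> y) / 2"]
        by (simp add: h heis_shear_def)
    qed
  qed
  moreover have "(\<lambda>p. F (heis_shear p)) \<in> borel_measurable borel" by measurable
  ultimately show ?thesis
    by (simp add: nn_integral_lborel_fst[OF F] nn_integral_lborel_fst)
qed

definition heis_polar :: "'n::finite heis \<times> 'n heis \<Rightarrow> 'n heisC" where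
  "heis_polar p = heisC_mult (heis_emb (fst p)) (heis_imag (snd p))"

lemma heis_polar_eq: "heis_polar p = re_im_join (heis_shear p)"
  by (simp add: heis_polar_def heisC_mult_heis_imag)

lemma heis_polar_measurable [measurable]: "heis_polar \<in> borel_measurable borel"
  unfolding heis_polar_eq[abs_def] using re_im_join_iso(1) by measurable

lemma nn_integral_heis_polar:
  fixes F :: "'n::finite heisC \<Rightarrow> ennreal"
  assumes [measurable]: "F \<in> borel_measurable borel"
  shows "(\<integral>\<^sup>+ g. F g \<partial>lborel) = (\<integral>\<^sup>+ p. F (heis_polar p) \<partial>lborel)"
proof -
  note [measurable] = re_im_join_iso(1)
  have "(\<integral>\<^sup>+ g. F g \<partial>lborel) = (\<integral>\<^sup>+ p. F (re_im_join p) \<partial>lborel)"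
    by (subst re_im_join_iso(2)[symmetric]) (simp add: nn_integral_distr)
  also have "\<dots> = (\<integral>\<^sup>+ p. F (heis_polar p) \<partial>lborel)"
    unfolding heis_polar_eq by (rule nn_integral_heis_shear[symmetric]) measurable
  finally show ?thesis .
qed

text \<open>The points \<open>heis_imag k\<close> form a null set, on which a Lebesgue measurable
  \<open>W\<close> has no evident measurability. Hence \<open>W0\<close> is a slice of a Borel
  version \<open>W'\<close> of \<open>W\<close> at a suitable \<open>h0\<close>; \<open>W'\<close>
  itself need not be invariant, but almost all of its slices agree almost everywhere.\<close>

lemma invariant_weight_reduction:
  fixes W :: "'n::finite heisC \<Rightarrow> real"
  assumes W: "W \<in> borel_measurable lebesgue"
    and inv: "\<And>h g. W (heisC_mult (heis_emb h) g) = W g"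
  shows "\<exists>W0 :: 'n heis \<Rightarrow> ennreal. W0 \<in> borel_measurable borel \<and>
    (\<forall>F\<in>borel_measurable borel. (\<integral>\<^sup>+ g. F g * ennreal (W g) \<partial>lebesgue) =
        (\<integral>\<^sup>+ k. (\<integral>\<^sup>+ h. F (heis_polar (h, k)) \<partial>lborel) * W0 k \<partial>lborel))"
proof -
  have "(\<lambda>g. ennreal (W g)) \<in> borel_measurable lebesgue" using W by measurable
  from completion_ex_borel_measurable[OF this]
  obtain W' where W'l: "W' \<in> borel_measurable lborel" and ae: "AE g in lborel. ennreal (W g) = W' g"
    by blast
  have [measurable]: "W' \<in> borel_measurable borel" using W'l by simp
  define w where "w k = ennreal (W (heis_imag k))" for k
  have Wp: "ennreal (W (heis_polar (h, k))) = w k" for h k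
    by (simp add: heis_polar_def inv w_def)
  obtain N where N: "{g \<in> space lborel. \<not> ennreal (W g) = W' g} \<subseteq> N" "emeasure lborel N = 0" "N \<in> sets lborel"
    using ae by (rule AE_E)
  have [measurable]: "N \<in> sets borel" using N by simp
  \<comment> \<open>Polar coordinates pull null sets back to null sets, which transports the
    exceptional set of \<open>W'\<close> to pairs \<open>(h, k)\<close>.\<close>
  have "(\<integral>\<^sup>+ p. indicator N (heis_polar p :: 'n heisC) \<partial>lborel) = 0"
    using nn_integral_heis_polar[of "indicator N"] N by simp
  then have "AE p in lborel. indicator N (heis_polar p :: 'n heisC) = (0::ennreal)"
    by (subst (asm) nn_integral_0_iff_AE) auto
  then have "AE p in lborel. (case p of (h, k) \<Rightarrow> w k = W' (heis_polar (h, k)))"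
  proof eventually_elim
    case (elim p)
    then have "ennreal (W (heis_polar p)) = W' (heis_polar p)"
      using N(1) by (auto simp: indicator_eq_0_iff)
    then show ?case using Wp[of "fst p" "snd p"] by (simp add: case_prod_unfold)
  qed
  then have "AE p in lborel \<Otimes>\<^sub>M lborel. (case p of (h, k) \<Rightarrow> w k = W' (heis_polar (h, k)))"
    unfolding lborel_prod .
  from lborel_pair.AE_pair[OF this] have AE2: "AE h in lborel. AE k in lborel. w k = W' (heis_polar (h, k))"
    by simp
  \<comment> \<open>Lebesgue measure is not zero, so what holds for almost every \<open>h\<close>
    holds for some \<open>h0\<close>.\<close>
  have "ae_filter (lborel :: 'n heis measure) \<noteq> bot"
    by (simp add: ae_filter_eq_bot_iff)
  with eventually_happens[OF AE2] obtain h0 where h0: "AE k in lborel. w k = W' (heis_polar (h0, k))"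
    by blast
  have pm: "(\<lambda>k. (h, k)) \<in> borel_measurable borel" "(\<lambda>h. (h, k)) \<in> borel_measurable borel" for h k :: "'n heis"
    by (intro borel_measurable_continuous_onI continuous_intros)+
  define W0 where "W0 k = W' (heis_polar (h0, k))" for k
  have [measurable]: "W0 \<in> borel_measurable borel"
    unfolding W0_def using pm(1)[of h0] by measurable
  show ?thesis
  proof (intro exI[of _ W0] conjI ballI)
    show "W0 \<in> borel_measurable borel" by measurable
    fix F :: "'n heisC \<Rightarrow> ennreal" assume [measurable]: "F \<in> borel_measurable borel"
    have sm: "(snd :: 'n heis \<times> 'n heis \<Rightarrow> 'n heis) \<in> borel_measurable borel"
      by (intro borel_measurable_continuous_onI continuous_intros)
    have "(\<integral>\<^sup>+ g. F g * ennreal (W g) \<partial>lebesgue) = (\<integral>\<^sup>+ g. F g * ennreal (W g) \<partial>lborel)"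
      by (rule nn_integral_completion)
    also have "\<dots> = (\<integral>\<^sup>+ g. F g * W' g \<partial>lborel)"
      by (intro nn_integral_cong_AE) (use ae in eventually_elim, simp)
    also have "\<dots> = (\<integral>\<^sup>+ p. F (heis_polar p) * W' (heis_polar p) \<partial>lborel)"
      by (rule nn_integral_heis_polar) measurable
    also have "\<dots> = (\<integral>\<^sup>+ h. \<integral>\<^sup>+ k. F (heis_polar (h, k)) * W' (heis_polar (h, k)) \<partial>lborel \<partial>lborel)"
      by (rule nn_integral_lborel_fst) measurable
    also have "\<dots> = (\<integral>\<^sup>+ h. \<integral>\<^sup>+ k. F (heis_polar (h, k)) * W0 k \<partial>lborel \<partial>lborel)"
    proof (intro nn_integral_cong_AE, use AE2 in eventually_elim)
      fix h assume "AE k in lborel. w k = W' (heis_polar (h, k))"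
      with h0 have "AE k in lborel. F (heis_polar (h, k)) * W' (heis_polar (h, k)) = F (heis_polar (h, k)) * W0 k"
        by eventually_elim (simp add: W0_def)
      then show "(\<integral>\<^sup>+ k. F (heis_polar (h, k)) * W' (heis_polar (h, k)) \<partial>lborel) = (\<integral>\<^sup>+ k. F (heis_polar (h, k)) * W0 k \<partial>lborel)"
        by (rule nn_integral_cong_AE)
    qed
    also have "\<dots> = (\<integral>\<^sup>+ p. F (heis_polar p) * W0 (snd p) \<partial>lborel)"
      using sm by (subst nn_integral_lborel_fst) (auto intro!: borel_measurable_times_ennreal measurable_compose[OF heis_polar_measurable] measurable_compose[OF sm])
    also have "\<dots> = (\<integral>\<^sup>+ k. \<integral>\<^sup>+ h. F (heis_polar (h, k)) * W0 k \<partial>lborel \<partial>lborel)"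
      using sm by (subst nn_integral_lborel_snd) (auto intro!: borel_measurable_times_ennreal measurable_compose[OF heis_polar_measurable] measurable_compose[OF sm])
    also have "\<dots> = (\<integral>\<^sup>+ k. (\<integral>\<^sup>+ h. F (heis_polar (h, k)) \<partial>lborel) * W0 k \<partial>lborel)"
      using pm(2) by (intro nn_integral_cong nn_integral_multc) measurable
    finally show "(\<integral>\<^sup>+ g. F g * ennreal (W g) \<partial>lebesgue) = (\<integral>\<^sup>+ k. (\<integral>\<^sup>+ h. F (heis_polar (h, k)) \<partial>lborel) * W0 k \<partial>lborel)" .
  qed
qed

section \<open>Norms over the fibres of the polar decomposition\<close>

lemma nn_integral_lborel_rotate:
  fixes f :: "'a::euclidean_space \<times> 'b::euclidean_space \<times> 'c::euclidean_space \<Rightarrow> ennreal"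
  assumes "f \<in> borel_measurable borel"
  shows "(\<integral>\<^sup>+ x. \<integral>\<^sup>+ y. \<integral>\<^sup>+ s. f (x, y, s) \<partial>lborel \<partial>lborel \<partial>lborel) =
    (\<integral>\<^sup>+ s. \<integral>\<^sup>+ x. \<integral>\<^sup>+ y. f (x, y, s) \<partial>lborel \<partial>lborel \<partial>lborel)"
proof -
  have [measurable]: "f \<in> borel_measurable (lborel \<Otimes>\<^sub>M lborel \<Otimes>\<^sub>M lborel)"
    using assms by (simp add: lborel_prod)
  have "(\<integral>\<^sup>+ x. \<integral>\<^sup>+ y. \<integral>\<^sup>+ s. f (x, y, s) \<partial>lborel \<partial>lborel \<partial>lborel) = (\<integral>\<^sup>+ x. \<integral>\<^sup>+ s. \<integral>\<^sup>+ y. f (x, y, s) \<partial>lborel \<partial>lborel \<partial>lborel)"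
    by (intro nn_integral_cong lborel_pair.Fubini'[symmetric]) measurable
  also have "\<dots> = (\<integral>\<^sup>+ s. \<integral>\<^sup>+ x. \<integral>\<^sup>+ y. f (x, y, s) \<partial>lborel \<partial>lborel \<partial>lborel)"
    by (intro lborel_pair.Fubini'[symmetric]) measurable
  finally show ?thesis .
qed

lemma nn_integral_gaussian_vec:
  fixes a :: real and c :: "real^'n::finite"
  assumes a: "a > 0"
  shows "(\<integral>\<^sup>+ x. ennreal (exp (- a * (x \<bullet> x) + c \<bullet> x)) \<partial>lborel) =
     ennreal (sqrt (pi / a) ^ CARD('n) * exp ((c \<bullet> c) / (4 * a)))"
proof -
  have 1: "exp (- complex_of_real (a * (x \<bullet> x)) + (\<Sum>j\<in>UNIV. cvec c $ j * of_real (x $ j))) = of_real (exp (- a * (x \<bullet> x) + c \<bullet> x))" for x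
    unfolding exp_of_real[symmetric] by (simp add: cvec_def inner_vec_def)
  have 2: "of_real (sqrt (pi / a) ^ CARD('n)) * exp (cdot (cvec c) (cvec c) / (4 * of_real a)) =
      complex_of_real (sqrt (pi / a) ^ CARD('n) * exp ((c \<bullet> c) / (4 * a)))"
    unfolding of_real_mult exp_of_real[symmetric] by (simp add: cvec_def inner_vec_def cdot_def)
  have hb: "has_bochner_integral lborel (\<lambda>x::real^'n. complex_of_real (exp (- a * (x \<bullet> x) + c \<bullet> x)))
     (of_real (sqrt (pi / a) ^ CARD('n) * exp ((c \<bullet> c) / (4 * a))))"
    using has_bochner_integral_gaussian_vec[OF a, of "cvec c"] unfolding 1 2 .
  have hr: "has_bochner_integral lborel (\<lambda>x::real^'n. exp (- a * (x \<bullet> x) + c \<bullet> x))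
     (sqrt (pi / a) ^ CARD('n) * exp ((c \<bullet> c) / (4 * a)))"
    using has_bochner_integral_Re[OF hb] unfolding Re_complex_of_real .
  show ?thesis
    using hr a by (intro nn_integral_eq_integral[THEN trans]) (auto simp: has_bochner_integral_iff)
qed

text \<open>\<open>conv_rate t a l\<close> is the mean of \<open>g = hk_rate t l\<close> and
  \<open>l^2 / (16 g)\<close> with weights \<open>a\<close> and \<open>g\<close>, so it lies between
  them. Writing \<open>d\<close> for it, both \<open>2 d\<close> and \<open>l^2 / (8 d)\<close> are
  then at most \<open>2 g\<close>, whatever \<open>a\<close> is; the last bound is AM-GM.\<close>

lemma conv_rate_bounds:
  assumes t: "t > 0" and a: "a > 0" and l: "l \<noteq> 0"
  shows "conv_rate t a l > 0" "conv_rate t a l \<le> hk_rate t l"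
    "2 * conv_rate t a l + l\<^sup>2 / (8 * conv_rate t a l) \<le> 4 * hk_rate t l"
    "\<bar>l\<bar> \<le> 2 * conv_rate t a l + l\<^sup>2 / (8 * conv_rate t a l)"
proof -
  define g d where "g = hk_rate t l" and "d = conv_rate t a l"
  note gb = hk_rate_bounds[OF t l, folded g_def]
  have d: "d = (a * g + l\<^sup>2 / 16) / (a + g)" by (simp add: d_def g_def conv_rate_def)
  show dp: "conv_rate t a l > 0" unfolding d_def[symmetric] d
    using a gb by (intro divide_pos_pos add_pos_nonneg mult_pos_pos) auto
  have "\<bar>l\<bar>\<^sup>2 \<le> (4 * g)\<^sup>2" using gb by (intro power_mono) auto
  then have lg: "l\<^sup>2 / 16 \<le> g\<^sup>2" by (simp add: power_mult_distrib)
  then show "conv_rate t a l \<le> hk_rate t l"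
    unfolding d_def[symmetric] d g_def[symmetric]
    using a gb by (simp add: pos_divide_le_eq algebra_simps power2_eq_square)
  moreover have "l\<^sup>2 / (8 * d) \<le> 2 * g"
  proof -
    have "a * (l\<^sup>2 / 16) \<le> a * g\<^sup>2" using lg a by (intro mult_left_mono) auto
    then have "l\<^sup>2 / 16 * (a + g) \<le> g * (a * g + l\<^sup>2 / 16)" by (simp add: algebra_simps power2_eq_square)
    then have "l\<^sup>2 / 16 \<le> g * d" unfolding d using a gb by (simp add: pos_le_divide_eq)
    then show ?thesis using dp unfolding d_def[symmetric] by (simp add: pos_divide_le_eq algebra_simps)
  qed
  ultimately show "2 * conv_rate t a l + l\<^sup>2 / (8 * conv_rate t a l) \<le> 4 * hk_rate t l"
    by (simp add: d_def g_def)
  have "0 \<le> (4 * d - \<bar>l\<bar>)\<^sup>2 / (8 * d)" using dp by (simp add: d_def)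
  also have "\<dots> = 2 * d + l\<^sup>2 / (8 * d) - \<bar>l\<bar>"
    using dp unfolding d_def[symmetric] by (simp add: power2_diff power_mult_distrib field_simps power2_eq_square)
  finally show "\<bar>l\<bar> \<le> 2 * conv_rate t a l + l\<^sup>2 / (8 * conv_rate t a l)"
    by (simp add: d_def)
qed

lemma conv_measurable [measurable]:
  "conv_rate t a \<in> borel_measurable borel" "conv_amp TYPE('n::finite) t a b \<in> borel_measurable borel"
  unfolding conv_rate_def[abs_def] conv_amp_def[abs_def] by measurable

lemma conv_amp_nonneg:
  assumes "t > 0" "a > 0" "b > 0"
  shows "conv_amp TYPE('n::finite) t a b l \<ge> 0"
proof (cases "l = 0")
  case True then show ?thesis by (simp add: conv_amp_def hk_amp_def power_0_left)
next
  case False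
  then show ?thesis
    using hk_amp_bounds(1)[OF assms(1) False] hk_rate_nonneg[OF assms(1), of l] assms
    by (simp add: conv_amp_def)
qed

lemma isCont_conv:
  assumes t: "t > 0" and a: "a > 0" and b: "b > 0" and l: "l \<noteq> 0"
  shows "isCont (conv_rate t a) l" "isCont (conv_amp TYPE('n::finite) t a b) l"
proof -
  have s: "sinh (t * l) \<noteq> 0" using t l by simp
  have r: "isCont (hk_rate t) l" unfolding hk_rate_def[abs_def] using s by (intro continuous_intros) auto
  have m: "isCont (hk_amp t) l" unfolding hk_amp_def[abs_def] using s by (intro continuous_intros) auto
  have p: "a + hk_rate t l \<noteq> 0" using a hk_rate_nonneg[OF t, of l] by simp
  show "isCont (conv_rate t a) l"
    unfolding conv_rate_def[abs_def] using p by (intro continuous_intros r) auto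
  show "isCont (conv_amp TYPE('n) t a b) l"
    unfolding conv_amp_def[abs_def] using p b by (intro continuous_intros r m) auto
qed

lemma borel_measurable_heat_transform_heis_gauss:
  assumes "t > 0" "a > 0" "b > 0"
  shows "heat_transform t (heis_gauss a b) \<in> borel_measurable (borel :: 'n::finite heisC measure)"
proof -
  have [measurable]: "(\<lambda>z::complex^'n. cdot z z) \<in> borel_measurable borel"
    unfolding cdot_def by (intro borel_measurable_continuous_onI continuous_intros)
  define F where "F = (\<lambda>((z::complex^'n, w::complex^'n, \<zeta>), l). exp (- \<i> * of_real l * \<zeta>) * of_real (conv_amp TYPE('n) t a b l) *
       exp (- of_real (conv_rate t a l) * (cdot z z + cdot w w)))"
  have "F \<in> borel_measurable borel"
    unfolding F_def borel_prod[symmetric] case_prod_unfold by measurable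
  then have "(\<lambda>g. LBINT l. F (g, l)) \<in> borel_measurable borel"
    by (rule borel_measurable_lborel_integral_fst)
  then have "(\<lambda>g. of_real ((4 * pi) powi (- int CARD('n))) * (LBINT l. F (g, l))) \<in> borel_measurable borel"
    by measurable
  also have "(\<lambda>g. of_real ((4 * pi) powi (- int CARD('n))) * (LBINT l. F (g, l))) = heat_transform t (heis_gauss a b)"
    by (auto simp: F_def heat_transform_heis_gauss[OF assms] fun_eq_iff)
  finally show ?thesis .
qed

text \<open>Along a central line the imaginary part \<open>e\<close> of the central coordinate is
  fixed; it moves from the character into the density as \<open>exp (l e)\<close>, after which the
  transform is an ordinary Fourier integral of \<open>G\<close>.\<close>

lemma nn_integral_heat_transform_center:
  fixes x u y v :: "real^'n::finite"
  assumes t: "t > 0" and a: "a > 0" and b: "b > 0"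
  defines "C \<equiv> (4 * pi) powi (- int CARD('n))"
  shows "(\<integral>\<^sup>+ \<xi>. ennreal ((cmod (heat_transform t (heis_gauss a b) (heis_polar ((x, u, \<xi>), (y, v, \<eta>)))))\<^sup>2) \<partial>lborel) =
    ennreal (2 * pi * C\<^sup>2) * (\<integral>\<^sup>+ l. ennreal ((conv_amp TYPE('n) t a b l)\<^sup>2 *
       exp (2 * l * \<eta> + l * (x \<bullet> v - u \<bullet> y) - 2 * conv_rate t a l * (x \<bullet> x + u \<bullet> u - y \<bullet> y - v \<bullet> v))) \<partial>lborel)"
proof -
  define e where "e = (x \<bullet> v - u \<bullet> y) / 2 + \<eta>"
  define z w where "z = (\<chi> j. Complex (x $ j) (y $ j))" and "w = (\<chi> j. Complex (u $ j) (v $ j))"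
  define S where "S = cdot z z + cdot w w"
  define Q where "Q = conv_amp TYPE('n) t a b"
  define G where "G l = of_real (exp (l * e) * Q l) * exp (- of_real (conv_rate t a l) * S)" for l
  have pol: "heis_polar ((x, u, \<xi>), (y, v, \<eta>)) = (z, w, Complex \<xi> e)" for \<xi>
    by (simp add: heis_polar_eq heis_shear_def re_im_join_def z_def w_def e_def)
  have ReS: "Re S = x \<bullet> x + u \<bullet> u - y \<bullet> y - v \<bullet> v"
    by (simp add: S_def z_def w_def cdot_def inner_vec_def sum_subtractf)
  have Cpos: "C \<ge> 0" unfolding C_def by simp
  have HT: "heat_transform t (heis_gauss a b) (heis_polar ((x, u, \<xi>), (y, v, \<eta>))) =
     of_real C * (LBINT l. exp (- \<i> * of_real l * of_real \<xi>) * G l)" for \<xi>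
  proof -
    have *: "exp (- \<i> * of_real l * Complex \<xi> e) = exp (- \<i> * of_real l * of_real \<xi>) * of_real (exp (l * e))" for l
      unfolding exp_of_real[symmetric] exp_add[symmetric] by (simp add: Complex_eq algebra_simps)
    show ?thesis
      unfolding pol heat_transform_heis_gauss[OF t a b] C_def[symmetric] * S_def[symmetric] Q_def[symmetric] G_def of_real_mult
      by (simp only: mult.assoc)
  qed
  have [measurable]: "Q \<in> borel_measurable borel" by (simp add: Q_def)
  have Gm: "G \<in> borel_measurable borel" unfolding G_def by measurable
  have nG: "cmod (G l) = exp (l * e) * Q l * exp (- conv_rate t a l * Re S)" for l
    using conv_amp_nonneg[OF t a b, of l, where ?'n = 'n] unfolding G_def norm_mult norm_of_real norm_exp_eq_Re Q_def
    by (simp add: abs_mult)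
  \<comment> \<open>\<open>B\<close> bounds the amplitude apart from \<open>exp (- t l^2)\<close>,
    and \<open>M\<close> the linear growth in \<open>|l|\<close>; again half of the Gaussian in
    \<open>l\<close> pays for \<open>M\<close>.\<close>
  define B where "B = (1 / t) ^ CARD('n) * sqrt (pi / b) * (pi / a) ^ CARD('n)"
  define M where "M = \<bar>e\<bar> + (y \<bullet> y + v \<bullet> v) / 4"
  define K where "K = B * exp (M\<^sup>2 / (2 * t) + (y \<bullet> y + v \<bullet> v) / (4 * t))"
  have B0: "B \<ge> 0" using t a b by (simp add: B_def)
  have bnd: "cmod (G l) \<le> K * exp (- (t / 2) * l\<^sup>2)" for l
  proof (cases "l = 0")
    case True
    then show ?thesis using B0 by (simp add: nG Q_def conv_amp_def hk_amp_def power_0_left K_def)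
  next
    case False
    note cb = conv_rate_bounds[OF t a False] and gb = hk_rate_bounds[OF t False] and mb = hk_amp_bounds[OF t False]
    have "Q l \<le> exp (- t * l\<^sup>2) * (1 / t) ^ CARD('n) * sqrt (pi / b) * (pi / a) ^ CARD('n)"
      unfolding Q_def conv_amp_def using t a b gb mb
      by (intro mult_mono power_mono) (auto intro!: divide_left_mono mult_pos_pos mult_nonneg_nonneg)
    also have "\<dots> = B * exp (- t * l\<^sup>2)" by (simp add: B_def)
    finally have Ql: "Q l \<le> B * exp (- t * l\<^sup>2)" .
    have "- conv_rate t a l * Re S \<le> conv_rate t a l * (y \<bullet> y + v \<bullet> v)"
      unfolding ReS using cb(1) mult_nonneg_nonneg[of "conv_rate t a l" "x \<bullet> x + u \<bullet> u"] by (simp add: algebra_simps)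
    also have "\<dots> \<le> ((\<bar>l\<bar> + 1 / t) / 4) * (y \<bullet> y + v \<bullet> v)"
      using cb(2) gb(2) by (intro mult_right_mono) auto
    finally have eS: "- conv_rate t a l * Re S \<le> ((\<bar>l\<bar> + 1 / t) / 4) * (y \<bullet> y + v \<bullet> v)" .
    have el: "l * e \<le> \<bar>l\<bar> * \<bar>e\<bar>" using abs_ge_self[of "l * e"] by (simp add: abs_mult)
    have "cmod (G l) \<le> exp (\<bar>l\<bar> * \<bar>e\<bar>) * (B * exp (- t * l\<^sup>2)) * exp (((\<bar>l\<bar> + 1 / t) / 4) * (y \<bullet> y + v \<bullet> v))"
      unfolding nG using B0 Ql el eS conv_amp_nonneg[OF t a b, of l, where ?'n = 'n]
      by (intro mult_mono) (auto simp: Q_def)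
    also have "\<dots> = B * exp (\<bar>l\<bar> * \<bar>e\<bar> + - t * l\<^sup>2 + ((\<bar>l\<bar> + 1 / t) / 4) * (y \<bullet> y + v \<bullet> v))"
      unfolding exp_add by (simp only: mult_ac)
    also have "\<dots> \<le> B * exp (M\<^sup>2 / (2 * t) + (y \<bullet> y + v \<bullet> v) / (4 * t) + - (t / 2) * l\<^sup>2)"
    proof (intro mult_left_mono exp_le_cancel_iff[THEN iffD2] B0)
      have "0 \<le> (t * \<bar>l\<bar> - M)\<^sup>2 / (2 * t)" using t by simp
      also have "\<dots> = t / 2 * l\<^sup>2 - M * \<bar>l\<bar> + M\<^sup>2 / (2 * t)"
        using t by (simp add: power2_diff power_mult_distrib field_simps power2_eq_square)
      finally have "M * \<bar>l\<bar> \<le> t / 2 * l\<^sup>2 + M\<^sup>2 / (2 * t)" by simp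
      moreover have "\<bar>l\<bar> * \<bar>e\<bar> + - t * l\<^sup>2 + ((\<bar>l\<bar> + 1 / t) / 4) * (y \<bullet> y + v \<bullet> v) =
         M * \<bar>l\<bar> + (y \<bullet> y + v \<bullet> v) / (4 * t) - (t / 2 * l\<^sup>2 + t / 2 * l\<^sup>2)"
        unfolding M_def using t by (simp add: field_simps)
      ultimately show "\<bar>l\<bar> * \<bar>e\<bar> + - t * l\<^sup>2 + ((\<bar>l\<bar> + 1 / t) / 4) * (y \<bullet> y + v \<bullet> v)
          \<le> M\<^sup>2 / (2 * t) + (y \<bullet> y + v \<bullet> v) / (4 * t) + - (t / 2) * l\<^sup>2" by linarith
    qed
    also have "\<dots> = K * exp (- (t / 2) * l\<^sup>2)" unfolding K_def exp_add by simp
    finally show ?thesis .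
  qed
  \<comment> \<open>Division by zero gives \<open>G 0 = 0\<close>, which is not the limit there; one
    point has to be left out.\<close>
  have cont: "AE l in lborel. isCont G l"
  proof -
    have "isCont G l" if "l \<noteq> 0" for l
      unfolding G_def Q_def using isCont_conv[OF t a b that]
      by (intro continuous_intros) auto
    then show ?thesis using AE_lborel_singleton[of "0::real"] by (auto elim: eventually_mono)
  qed
  have "(\<integral>\<^sup>+ \<xi>. ennreal ((cmod (heat_transform t (heis_gauss a b) (heis_polar ((x, u, \<xi>), (y, v, \<eta>)))))\<^sup>2) \<partial>lborel) =
     (\<integral>\<^sup>+ \<xi>. ennreal (C\<^sup>2) * ennreal ((cmod (LBINT l. exp (- \<i> * of_real l * of_real \<xi>) * G l))\<^sup>2) \<partial>lborel)"
    unfolding HT norm_mult norm_of_real power_mult_distrib power2_abs by (simp add: ennreal_mult)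
  also have "\<dots> = ennreal (C\<^sup>2) * (\<integral>\<^sup>+ \<xi>. ennreal ((cmod (LBINT l. exp (- \<i> * of_real l * of_real \<xi>) * G l))\<^sup>2) \<partial>lborel)"
  proof (rule nn_integral_cmult)
    have "(\<lambda>\<xi>. LBINT l. exp (- \<i> * of_real l * of_real \<xi>) * G l) \<in> borel_measurable borel"
      using Gm borel_measurable_lborel_integral_fst[of "\<lambda>(\<xi>, l). exp (- \<i> * of_real l * of_real \<xi>) * G l"]
      by (simp add: borel_prod[symmetric])
    then show "(\<lambda>\<xi>. ennreal ((cmod (LBINT l. exp (- \<i> * of_real l * of_real \<xi>) * G l))\<^sup>2)) \<in> borel_measurable lborel"
      by measurable
  qed
  also have "\<dots> = ennreal (C\<^sup>2) * (ennreal (2 * pi) * (\<integral>\<^sup>+ l. ennreal ((cmod (G l))\<^sup>2) \<partial>lborel))"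
    using plancherel_real_line[OF Gm _ bnd cont] t by simp
  also have "\<dots> = ennreal (2 * pi * C\<^sup>2) * (\<integral>\<^sup>+ l. ennreal ((cmod (G l))\<^sup>2) \<partial>lborel)"
    by (simp add: ennreal_mult mult_ac)
  finally have fin: "(\<integral>\<^sup>+ \<xi>. ennreal ((cmod (heat_transform t (heis_gauss a b) (heis_polar ((x, u, \<xi>), (y, v, \<eta>)))))\<^sup>2) \<partial>lborel) =
    ennreal (2 * pi * C\<^sup>2) * (\<integral>\<^sup>+ l. ennreal ((cmod (G l))\<^sup>2) \<partial>lborel)" .
  have sq: "(cmod (G l))\<^sup>2 = (Q l)\<^sup>2 * exp (2 * l * \<eta> + l * (x \<bullet> v - u \<bullet> y) - 2 * conv_rate t a l * (x \<bullet> x + u \<bullet> u - y \<bullet> y - v \<bullet> v))" for l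
  proof -
    have "(cmod (G l))\<^sup>2 = (Q l)\<^sup>2 * exp (2 * (l * e) + 2 * (- conv_rate t a l * Re S))"
      unfolding nG power_mult_distrib exp_add exp_double by (simp only: mult_ac)
    also have "2 * (l * e) + 2 * (- conv_rate t a l * Re S) = 2 * l * \<eta> + l * (x \<bullet> v - u \<bullet> y) - 2 * conv_rate t a l * (x \<bullet> x + u \<bullet> u - y \<bullet> y - v \<bullet> v)"
      unfolding e_def ReS by (simp add: field_simps)
    finally show ?thesis .
  qed
  show ?thesis unfolding fin sq Q_def ..
qed

text \<open>The density \<open>p\<close> of the overview, up to the constant
  \<open>2 pi C^2\<close>. The second factor is what the integrals over \<open>x\<close> and
  \<open>u\<close> contribute: two factors \<open>sqrt (pi / (2 d))\<close> per index,
  \<open>d\<close> being the rate.\<close>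

definition fibre_density :: "'n::finite itself \<Rightarrow> real \<Rightarrow> real \<Rightarrow> real \<Rightarrow> real \<Rightarrow> real" where
  "fibre_density _ t a b l = (conv_amp TYPE('n) t a b l)\<^sup>2 * (pi / (2 * conv_rate t a l)) ^ CARD('n)"

text \<open>The function theta of the overview. Its second term arises on completing the squares
  with the linear terms \<open>l (x . v)\<close> and \<open>- l (u . y)\<close>.\<close>

definition fibre_exponent :: "real \<Rightarrow> real \<Rightarrow> real \<Rightarrow> real" where
  "fibre_exponent t a l = 2 * conv_rate t a l + l\<^sup>2 / (8 * conv_rate t a l)"

lemma fibre_measurable [measurable]:
  "fibre_density TYPE('n::finite) t a b \<in> borel_measurable borel" "fibre_exponent t a \<in> borel_measurable borel"
  unfolding fibre_density_def[abs_def] fibre_exponent_def[abs_def] by measurable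

lemma fibre_even [simp]:
  "fibre_density TYPE('n::finite) t a b (- l) = fibre_density TYPE('n) t a b l"
  "fibre_exponent t a (- l) = fibre_exponent t a l"
  by (simp_all add: fibre_density_def fibre_exponent_def conv_amp_def conv_rate_def)

text \<open>The integrand is non-negative, so \<open>l\<close> may be moved outermost; the integrals
  over \<open>x\<close> and \<open>u\<close> are then real Gaussians, and completing the squares
  leaves \<open>y\<close> and \<open>v\<close> only through \<open>|y|^2 + |v|^2\<close>.\<close>

lemma nn_integral_heat_transform_fibre:
  fixes y v :: "real^'n::finite"
  assumes t: "t > 0" and a: "a > 0" and b: "b > 0"
  defines "C \<equiv> (4 * pi) powi (- int CARD('n))"
  shows "(\<integral>\<^sup>+ h. ennreal ((cmod (heat_transform t (heis_gauss a b) (heis_polar (h, (y, v, \<eta>)))))\<^sup>2) \<partial>lborel) =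
    ennreal (2 * pi * C\<^sup>2) * (\<integral>\<^sup>+ l. ennreal (fibre_density TYPE('n) t a b l *
       exp (2 * l * \<eta> + fibre_exponent t a l * (y \<bullet> y + v \<bullet> v))) \<partial>lborel)"
proof -
  define \<Phi> where "\<Phi> = (\<lambda>(x, u, l). ennreal ((conv_amp TYPE('n) t a b l)\<^sup>2 *
       exp (2 * l * \<eta> + l * (x \<bullet> v - u \<bullet> y) - 2 * conv_rate t a l * (x \<bullet> x + u \<bullet> u - y \<bullet> y - v \<bullet> v))))"
  have \<Phi>m: "\<Phi> \<in> borel_measurable borel"
    unfolding \<Phi>_def borel_prod[symmetric] case_prod_unfold by measurable
  have \<Phi>m': "\<Phi> \<in> borel_measurable (lborel \<Otimes>\<^sub>M lborel \<Otimes>\<^sub>M lborel)"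
    using \<Phi>m by (simp add: lborel_prod)
  note [measurable] = \<Phi>m'
  have m: "(\<lambda>h. ennreal ((cmod (heat_transform t (heis_gauss a b) (heis_polar (h, (y, v, \<eta>)))))\<^sup>2)) \<in> borel_measurable borel"
  proof -
    have "(\<lambda>h. (h, (y, v, \<eta>))) \<in> borel_measurable borel"
      by (intro borel_measurable_continuous_onI continuous_intros)
    from measurable_compose[OF measurable_compose[OF this heis_polar_measurable] borel_measurable_heat_transform_heis_gauss[OF t a b]]
    show ?thesis by measurable
  qed
  have "(\<integral>\<^sup>+ h. ennreal ((cmod (heat_transform t (heis_gauss a b) (heis_polar (h, (y, v, \<eta>)))))\<^sup>2) \<partial>lborel) =
     (\<integral>\<^sup>+ x. \<integral>\<^sup>+ u. ennreal (2 * pi * C\<^sup>2) * (\<integral>\<^sup>+ l. \<Phi> (x, u, l) \<partial>lborel) \<partial>lborel \<partial>lborel)"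
    unfolding nn_integral_lborel_triple[OF m] nn_integral_heat_transform_center[OF t a b] \<Phi>_def prod.case C_def ..
  also have "\<dots> = (\<integral>\<^sup>+ x. ennreal (2 * pi * C\<^sup>2) * (\<integral>\<^sup>+ u. \<integral>\<^sup>+ l. \<Phi> (x, u, l) \<partial>lborel \<partial>lborel) \<partial>lborel)"
    by (intro nn_integral_cong nn_integral_cmult) measurable
  also have "\<dots> = ennreal (2 * pi * C\<^sup>2) * (\<integral>\<^sup>+ x. \<integral>\<^sup>+ u. \<integral>\<^sup>+ l. \<Phi> (x, u, l) \<partial>lborel \<partial>lborel \<partial>lborel)"
    by (intro nn_integral_cmult) measurable
  also have "(\<integral>\<^sup>+ x. \<integral>\<^sup>+ u. \<integral>\<^sup>+ l. \<Phi> (x, u, l) \<partial>lborel \<partial>lborel \<partial>lborel) = (\<integral>\<^sup>+ l. \<integral>\<^sup>+ x. \<integral>\<^sup>+ u. \<Phi> (x, u, l) \<partial>lborel \<partial>lborel \<partial>lborel)"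
    by (rule nn_integral_lborel_rotate[OF \<Phi>m])
  also have "\<dots> = (\<integral>\<^sup>+ l. ennreal (fibre_density TYPE('n) t a b l *
       exp (2 * l * \<eta> + fibre_exponent t a l * (y \<bullet> y + v \<bullet> v))) \<partial>lborel)"
  proof (rule nn_integral_cong_AE)
    have "(\<integral>\<^sup>+ x. \<integral>\<^sup>+ u. \<Phi> (x, u, l) \<partial>lborel \<partial>lborel) = ennreal (fibre_density TYPE('n) t a b l *
       exp (2 * l * \<eta> + fibre_exponent t a l * (y \<bullet> y + v \<bullet> v)))" if l: "l \<noteq> 0" for l
    proof -
      define d where "d = conv_rate t a l"
      have d: "2 * d > 0" using conv_rate_bounds(1)[OF t a l] by (simp add: d_def)
      define Q where "Q = (conv_amp TYPE('n) t a b l)\<^sup>2 * exp (2 * l * \<eta> + 2 * d * (y \<bullet> y + v \<bullet> v))"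
      have Q0: "Q \<ge> 0" by (simp add: Q_def)
      have \<Phi>: "\<Phi> (x, u, l) = ennreal Q * (ennreal (exp (- (2 * d) * (x \<bullet> x) + (l *\<^sub>R v) \<bullet> x)) * ennreal (exp (- (2 * d) * (u \<bullet> u) + (- l *\<^sub>R y) \<bullet> u)))" for x u
      proof -
        have "(conv_amp TYPE('n) t a b l)\<^sup>2 * exp (2 * l * \<eta> + l * (x \<bullet> v - u \<bullet> y) - 2 * d * (x \<bullet> x + u \<bullet> u - y \<bullet> y - v \<bullet> v)) =
          Q * (exp (- (2 * d) * (x \<bullet> x) + (l *\<^sub>R v) \<bullet> x) * exp (- (2 * d) * (u \<bullet> u) + (- l *\<^sub>R y) \<bullet> u))"
          unfolding Q_def mult.assoc[of "(conv_amp TYPE('n) t a b l)\<^sup>2"] exp_add[symmetric]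
          by (simp add: algebra_simps inner_commute)
        then show ?thesis using Q0 unfolding \<Phi>_def prod.case d_def[symmetric] by (simp only: ennreal_mult[OF Q0] ennreal_mult exp_ge_zero mult_nonneg_nonneg)
      qed
      have "(\<integral>\<^sup>+ x. \<integral>\<^sup>+ u. \<Phi> (x, u, l) \<partial>lborel \<partial>lborel) = ennreal Q * ((\<integral>\<^sup>+ x. ennreal (exp (- (2 * d) * (x \<bullet> (x :: real^'n)) + (l *\<^sub>R v) \<bullet> x)) \<partial>lborel) *
          (\<integral>\<^sup>+ u. ennreal (exp (- (2 * d) * (u \<bullet> (u :: real^'n)) + (- l *\<^sub>R y) \<bullet> u)) \<partial>lborel))"
        unfolding \<Phi> by (simp add: nn_integral_cmult nn_integral_multc del: inner_scaleR_left)
      also have "\<dots> = ennreal (Q * ((sqrt (pi / (2 * d)) ^ CARD('n) * exp (((l *\<^sub>R v) \<bullet> (l *\<^sub>R v)) / (4 * (2 * d)))) *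
           (sqrt (pi / (2 * d)) ^ CARD('n) * exp (((- l *\<^sub>R y) \<bullet> (- l *\<^sub>R y)) / (4 * (2 * d))))))"
        unfolding nn_integral_gaussian_vec[OF d] using Q0 d by (simp add: ennreal_mult)
      also have "Q * ((sqrt (pi / (2 * d)) ^ CARD('n) * exp (((l *\<^sub>R v) \<bullet> (l *\<^sub>R v)) / (4 * (2 * d)))) *
           (sqrt (pi / (2 * d)) ^ CARD('n) * exp (((- l *\<^sub>R y) \<bullet> (- l *\<^sub>R y)) / (4 * (2 * d))))) =
         (conv_amp TYPE('n) t a b l)\<^sup>2 * (sqrt (pi / (2 * d)) * sqrt (pi / (2 * d))) ^ CARD('n) *
          exp ((2 * l * \<eta> + 2 * d * (y \<bullet> y + v \<bullet> v)) + ((l *\<^sub>R v) \<bullet> (l *\<^sub>R v)) / (4 * (2 * d)) + ((- l *\<^sub>R y) \<bullet> (- l *\<^sub>R y)) / (4 * (2 * d)))"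
        unfolding Q_def exp_add power_mult_distrib by (simp only: mult_ac)
      also have "sqrt (pi / (2 * d)) * sqrt (pi / (2 * d)) = pi / (2 * d)" using d by simp
      also have "(2 * l * \<eta> + 2 * d * (y \<bullet> y + v \<bullet> v)) + ((l *\<^sub>R v) \<bullet> (l *\<^sub>R v)) / (4 * (2 * d)) + ((- l *\<^sub>R y) \<bullet> (- l *\<^sub>R y)) / (4 * (2 * d)) =
         2 * l * \<eta> + fibre_exponent t a l * (y \<bullet> y + v \<bullet> v)"
        unfolding fibre_exponent_def d_def[symmetric] using d by (simp add: field_simps power2_eq_square)
      finally show ?thesis unfolding fibre_density_def d_def .
    qed
    then show "AE l in lborel. (\<integral>\<^sup>+ x. \<integral>\<^sup>+ u. \<Phi> (x, u, l) \<partial>lborel \<partial>lborel) = ennreal (fibre_density TYPE('n) t a b l *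
       exp (2 * l * \<eta> + fibre_exponent t a l * (y \<bullet> y + v \<bullet> v)))"
      using AE_lborel_singleton[of "0::real"] by (auto elim: eventually_mono)
  qed
  finally show ?thesis .
qed

text \<open>The squared modulus is again such a Gaussian, with both parameters doubled.\<close>

lemma heis_gauss_L2:
  assumes a: "a > 0" and b: "b > 0"
  shows "(heis_gauss a b :: 'n::finite heis \<Rightarrow> complex) \<in> L2_heis"
    "(\<integral>\<^sup>+ h. ennreal ((cmod (heis_gauss a b (h :: 'n heis)))\<^sup>2) \<partial>lebesgue) = ennreal ((pi / (2 * a)) ^ CARD('n) * sqrt (pi / (2 * b)))"
proof -
  have sq: "complex_of_real ((cmod (heis_gauss a b h))\<^sup>2) = heis_gauss (2 * a) (2 * b) h" for h :: "'n heis"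
    by (cases h) (simp add: heis_gauss_def exp_double[symmetric] algebra_simps flip: of_real_power)
  have hb: "has_bochner_integral lborel (\<lambda>h::'n heis. complex_of_real ((cmod (heis_gauss a b h))\<^sup>2))
     (of_real ((pi / (2 * a)) ^ CARD('n) * sqrt (pi / (2 * b))))"
    unfolding sq using a b by (intro has_bochner_integral_heis_gauss) auto
  have hr: "has_bochner_integral lborel (\<lambda>h::'n heis. (cmod (heis_gauss a b h))\<^sup>2) ((pi / (2 * a)) ^ CARD('n) * sqrt (pi / (2 * b)))"
    using has_bochner_integral_Re[OF hb] unfolding Re_complex_of_real .
  have m: "(heis_gauss a b :: 'n heis \<Rightarrow> complex) \<in> borel_measurable borel"
    using has_bochner_integral_heis_gauss[OF a b, where ?'n = 'n] by (auto simp: has_bochner_integral_iff)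
  have i: "integrable lborel (\<lambda>h::'n heis. (cmod (heis_gauss a b h))\<^sup>2)" using hr by (simp add: has_bochner_integral_iff)
  have "(heis_gauss a b :: 'n heis \<Rightarrow> complex) \<in> borel_measurable lebesgue"
    using m by (simp add: measurable_completion)
  moreover have "integrable lebesgue (\<lambda>h::'n heis. (cmod (heis_gauss a b h))\<^sup>2)"
    using i borel_measurable_integrable[OF i] by (simp add: integrable_completion)
  ultimately show "(heis_gauss a b :: 'n heis \<Rightarrow> complex) \<in> L2_heis"
    by (simp add: L2_heis_def)
  show "(\<integral>\<^sup>+ h. ennreal ((cmod (heis_gauss a b (h :: 'n heis)))\<^sup>2) \<partial>lebesgue) = ennreal ((pi / (2 * a)) ^ CARD('n) * sqrt (pi / (2 * b)))"
    unfolding nn_integral_completion using hr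
    by (intro nn_integral_eq_integral[THEN trans]) (auto simp: has_bochner_integral_iff)
qed

section \<open>Comparison of two Gaussians\<close>

text \<open>The power of \<open>a\<close> comes from \<open>(pi / (a + g))^n\<close> inside the
  squared amplitude, with \<open>g\<close> the kernel rate; everything else is bounded uniformly in
  \<open>a >= 1\<close>. The exponent is \<open>2 t + 1 / (2 b)\<close> at
  \<open>b = 1 / 2\<close>.\<close>

lemma fibre_density_upper:
  assumes t: "t > 0"
  shows "\<exists>c\<ge>0. \<forall>a\<ge>1. \<forall>l. l \<noteq> 0 \<longrightarrow>
    fibre_density TYPE('n::finite) t a (1 / 2) l \<le> c / a ^ (2 * CARD('n)) * exp (- (2 * t + 1) * l\<^sup>2)"
proof (intro exI conjI allI impI)
  let ?n = "CARD('n)"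
  let ?c = "((1 / t) ^ ?n * sqrt (2 * pi) * pi ^ ?n)\<^sup>2 * (pi * (4 * t + 1) / 2) ^ ?n"
  show "?c \<ge> 0" using t by simp
  fix a l :: real assume a: "1 \<le> a" and l: "l \<noteq> 0"
  have a0: "a > 0" using a by simp
  define g d where "g = hk_rate t l" and "d = conv_rate t a l"
  note gb = hk_rate_bounds[OF t l, folded g_def] and mb = hk_amp_bounds[OF t l]
  have "conv_amp TYPE('n) t a (1 / 2) l \<le> exp (- t * l\<^sup>2 - l\<^sup>2 / (4 * (1 / 2))) * (1 / t) ^ ?n * sqrt (pi / (1 / 2)) * (pi / a) ^ ?n"
    unfolding conv_amp_def g_def[symmetric] using t a0 gb mb
    by (intro mult_mono power_mono) (auto intro!: divide_left_mono mult_pos_pos)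
  then have "(conv_amp TYPE('n) t a (1 / 2) l)\<^sup>2 \<le> (exp (- t * l\<^sup>2 - l\<^sup>2 / 2) * (1 / t) ^ ?n * sqrt (2 * pi) * (pi / a) ^ ?n)\<^sup>2"
    using conv_amp_nonneg[OF t a0, of "1 / 2" l, where ?'n = 'n] by (intro power_mono) (auto simp: mult.commute)
  also have "\<dots> = ((1 / t) ^ ?n * sqrt (2 * pi) * pi ^ ?n)\<^sup>2 * (exp (- t * l\<^sup>2 - l\<^sup>2 / 2))\<^sup>2 / (a ^ ?n)\<^sup>2"
    using t a0 by (simp add: power_mult_distrib power_divide field_simps)
  also have "(exp (- t * l\<^sup>2 - l\<^sup>2 / 2))\<^sup>2 = exp (- (2 * t + 1) * l\<^sup>2)"
    unfolding exp_double[symmetric] by (simp add: algebra_simps)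
  also have "(a ^ ?n)\<^sup>2 = a ^ (2 * ?n)" by (simp add: power_mult[symmetric] mult.commute)
  finally have Q: "(conv_amp TYPE('n) t a (1 / 2) l)\<^sup>2 \<le> ((1 / t) ^ ?n * sqrt (2 * pi) * pi ^ ?n)\<^sup>2 * exp (- (2 * t + 1) * l\<^sup>2) / a ^ (2 * ?n)" .
  \<comment> \<open>From \<open>1 <= 4 t g\<close> and \<open>g <= a g\<close> follows
    \<open>a + g <= (4 t + 1) a g\<close>, and \<open>a g\<close> is at most the numerator of
    \<open>d\<close>.\<close>
  have "1 / (4 * t + 1) \<le> d"
  proof -
    have "1 \<le> 4 * t * g" using gb(3) t by (simp add: field_simps)
    then have "a * 1 \<le> a * (4 * t * g)" using a0 by (intro mult_left_mono) auto
    moreover have "g \<le> a * g" using a gb(4) by simp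
    ultimately have "a + g \<le> (a * g) * (4 * t + 1)" by (simp add: algebra_simps)
    also have "\<dots> \<le> (a * g + l\<^sup>2 / 16) * (4 * t + 1)" using t by (intro mult_right_mono) auto
    finally show ?thesis
      unfolding d_def conv_rate_def g_def[symmetric] using t a0 gb(4)
      by (simp add: divide_le_eq pos_le_divide_eq mult.commute)
  qed
  then have "pi / (2 * d) \<le> pi / (2 * (1 / (4 * t + 1)))"
    using t conv_rate_bounds(1)[OF t a0 l] unfolding d_def[symmetric] by (intro divide_left_mono mult_left_mono mult_pos_pos) auto
  then have "pi / (2 * d) \<le> pi * (4 * t + 1) / 2" by simp
  then have "(pi / (2 * d)) ^ ?n \<le> (pi * (4 * t + 1) / 2) ^ ?n"
    using conv_rate_bounds(1)[OF t a0 l] unfolding d_def[symmetric] by (intro power_mono) auto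
  then have "fibre_density TYPE('n) t a (1 / 2) l \<le>
     (((1 / t) ^ ?n * sqrt (2 * pi) * pi ^ ?n)\<^sup>2 * exp (- (2 * t + 1) * l\<^sup>2) / a ^ (2 * ?n)) * (pi * (4 * t + 1) / 2) ^ ?n"
    unfolding fibre_density_def d_def[symmetric] using t a0 Q conv_rate_bounds(1)[OF t a0 l, folded d_def]
    by (intro mult_mono) auto
  then show "fibre_density TYPE('n) t a (1 / 2) l \<le> ?c / a ^ (2 * ?n) * exp (- (2 * t + 1) * l\<^sup>2)"
    by (simp add: mult_ac)
qed

text \<open>At \<open>b = 1\<close> the quadratic coefficient \<open>2 t + 1 / (2 b)\<close> is only
  \<open>2 t + 1 / 2\<close>. Polynomial factors are replaced by exponentials through
  \<open>1 + s <= exp s\<close>. In the coefficient of \<open>n m\<close>, the part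
  \<open>2 t\<close> comes from \<open>hk_amp\<close>, one unit from \<open>(1 + g)^(- 2 n)\<close>
  and one from \<open>(2 d)^(- n)\<close>.\<close>

lemma fibre_density_lower:
  assumes t: "t > 0"
  shows "\<exists>c>0. \<forall>m\<ge>1 / t. c * exp (- (2 * t + 1 / 2) * m\<^sup>2 - real CARD('n::finite) * (2 * t + 2) * m) \<le> fibre_density TYPE('n) t 1 1 m"
proof (intro exI conjI allI impI)
  let ?n = "CARD('n)"
  let ?c = "((2 / t) ^ ?n * sqrt pi * pi ^ ?n)\<^sup>2 * pi ^ ?n"
  show "?c > 0" using t by simp
  fix m :: real assume m: "1 / t \<le> m"
  have m0: "m > 0" using m t by (meson divide_pos_pos less_le_trans zero_less_one)
  then have mn: "m \<noteq> 0" by simp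
  define g d where "g = hk_rate t m" and "d = conv_rate t 1 m"
  note gb = hk_rate_bounds[OF t mn, folded g_def] and mb = hk_amp_bounds[OF t mn]
  note db = conv_rate_bounds[OF t _ mn, of 1, simplified, folded d_def g_def]
  \<comment> \<open>Here \<open>m >= 1 / t\<close> turns the bound \<open>m + 1 / t\<close> into
    \<open>2 m\<close>; below, it replaces a factor \<open>2 m\<close> by a constant.\<close>
  have g2: "4 * g \<le> 2 * m" using gb(2) m m0 by simp
  have "1 + g \<le> 1 + m / 2" using g2 by simp
  also have "\<dots> \<le> exp (m / 2)" by (rule exp_ge_add_one_self)
  finally have "pi / exp (m / 2) \<le> pi / (1 + g)" using gb(4) by (intro divide_left_mono) auto
  then have e1: "pi * exp (- m / 2) \<le> pi / (1 + g)" by (simp add: exp_minus field_simps)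
  have "2 * d \<le> 1 + m" using db(2) g2 by simp
  also have "\<dots> \<le> exp m" by (rule exp_ge_add_one_self)
  finally have "pi / exp m \<le> pi / (2 * d)" using db(1) by (intro divide_left_mono) auto
  then have e2: "pi * exp (- m) \<le> pi / (2 * d)" by (simp add: exp_minus field_simps)
  have "2 / t * exp (- t * m) \<le> 2 * m * exp (- t * m)" using m by (intro mult_right_mono) (auto simp: field_simps)
  also have "\<dots> \<le> hk_amp t m" using mb(3) m0 by simp
  finally have e3: "2 / t * exp (- t * m) \<le> hk_amp t m" .
  have "exp (- t * m\<^sup>2 - m\<^sup>2 / 4) * (2 / t * exp (- t * m)) ^ ?n * sqrt pi * (pi * exp (- m / 2)) ^ ?n \<le> conv_amp TYPE('n) t 1 1 m"
    unfolding conv_amp_def g_def[symmetric] using e1 e3 t gb(4) mb(1) less_imp_le[OF mb(1)]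
    by (intro mult_mono power_mono) (auto)
  then have "(exp (- t * m\<^sup>2 - m\<^sup>2 / 4) * (2 / t * exp (- t * m)) ^ ?n * sqrt pi * (pi * exp (- m / 2)) ^ ?n)\<^sup>2 * (pi * exp (- m)) ^ ?n
     \<le> (conv_amp TYPE('n) t 1 1 m)\<^sup>2 * (pi / (2 * d)) ^ ?n"
    using e2 t by (intro mult_mono power_mono) auto
  moreover have "(exp (- t * m\<^sup>2 - m\<^sup>2 / 4) * (2 / t * exp (- t * m)) ^ ?n * sqrt pi * (pi * exp (- m / 2)) ^ ?n)\<^sup>2 * (pi * exp (- m)) ^ ?n
     = ?c * exp (- (2 * t + 1 / 2) * m\<^sup>2 - real ?n * (2 * t + 2) * m)"
  proof -
    have "(exp (- t * m\<^sup>2 - m\<^sup>2 / 4) * (2 / t * exp (- t * m)) ^ ?n * sqrt pi * (pi * exp (- m / 2)) ^ ?n)\<^sup>2 * (pi * exp (- m)) ^ ?n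
      = ?c * ((exp (- t * m\<^sup>2 - m\<^sup>2 / 4))\<^sup>2 * (exp (- t * m) ^ ?n)\<^sup>2 * (exp (- m / 2) ^ ?n)\<^sup>2 * exp (- m) ^ ?n)"
      by (simp only: power_mult_distrib mult_ac)
    also have "(exp (- t * m\<^sup>2 - m\<^sup>2 / 4))\<^sup>2 * (exp (- t * m) ^ ?n)\<^sup>2 * (exp (- m / 2) ^ ?n)\<^sup>2 * exp (- m) ^ ?n =
       exp (2 * (- t * m\<^sup>2 - m\<^sup>2 / 4) + 2 * (real ?n * (- t * m)) + 2 * (real ?n * (- m / 2)) + real ?n * (- m))"
      unfolding exp_add exp_double exp_of_nat_mult ..
    also have "2 * (- t * m\<^sup>2 - m\<^sup>2 / 4) + 2 * (real ?n * (- t * m)) + 2 * (real ?n * (- m / 2)) + real ?n * (- m) =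
       - (2 * t + 1 / 2) * m\<^sup>2 - real ?n * (2 * t + 2) * m"
      by (simp add: algebra_simps)
    finally show ?thesis .
  qed
  ultimately show "?c * exp (- (2 * t + 1 / 2) * m\<^sup>2 - real ?n * (2 * t + 2) * m) \<le> fibre_density TYPE('n) t 1 1 m"
    unfolding fibre_density_def d_def by simp
qed

text \<open>In terms of \<open>m = |l| + 1 / t\<close>, the two quadratic exponents differ by the
  surplus \<open>m^2 / 2\<close>. It absorbs the linear terms, which come from the shift and from
  the lower estimate, at the cost of a constant.\<close>

lemma fibre_density_compare:
  assumes t: "t > 0"
  shows "\<exists>K>0. \<forall>a\<ge>1. \<forall>l. l \<noteq> 0 \<longrightarrow>
    fibre_density TYPE('n::finite) t a (1 / 2) l \<le> K / a ^ (2 * CARD('n)) * fibre_density TYPE('n) t 1 1 (\<bar>l\<bar> + 1 / t)"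
proof -
  let ?n = "CARD('n)"
  obtain c where c: "c \<ge> 0" "\<And>a l. a \<ge> 1 \<Longrightarrow> l \<noteq> 0 \<Longrightarrow> fibre_density TYPE('n) t a (1 / 2) l \<le> c / a ^ (2 * ?n) * exp (- (2 * t + 1) * l\<^sup>2)"
    using fibre_density_upper[OF t] by blast
  obtain c' where c': "c' > 0" "\<And>m. m \<ge> 1 / t \<Longrightarrow> c' * exp (- (2 * t + 1 / 2) * m\<^sup>2 - real ?n * (2 * t + 2) * m) \<le> fibre_density TYPE('n) t 1 1 m"
    using fibre_density_lower[OF t] by blast
  \<comment> \<open>The total coefficient of the linear terms.
    \<open>P m - m^2 / 2 <= P^2 / 2\<close> explains \<open>K\<close>, and \<open>c + 1\<close>
    keeps \<open>K\<close> positive even for \<open>c = 0\<close>.\<close>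
  define P where "P = 2 * (2 * t + 1) * (1 / t) + real ?n * (2 * t + 2)"
  define K where "K = (c + 1) * exp (P\<^sup>2 / 2) / c'"
  show ?thesis
  proof (intro exI[of _ K] conjI allI impI)
    show "K > 0" using c c' by (simp add: K_def)
    fix a l :: real assume a: "1 \<le> a" and l: "l \<noteq> 0"
    define m where "m = \<bar>l\<bar> + 1 / t"
    have m: "m \<ge> 1 / t" by (simp add: m_def)
    have "- (2 * t + 1) * l\<^sup>2 \<le> P\<^sup>2 / 2 + (- (2 * t + 1 / 2) * m\<^sup>2 - real ?n * (2 * t + 2) * m)"
    proof -
      have "l\<^sup>2 = (m - 1 / t)\<^sup>2" by (simp add: m_def)
      moreover have "(2 * T * M + N)\<^sup>2 / 2 + (- (T - 1 / 2) * m\<^sup>2 - N * m) + T * (m - M)\<^sup>2 = (m - (2 * T * M + N))\<^sup>2 / 2 + T * M\<^sup>2"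
        for T M N :: real
        by (simp add: power2_eq_square field_simps)
      moreover have "2 * t + 1 / 2 = (2 * t + 1) - 1 / 2" by simp
      ultimately have "P\<^sup>2 / 2 + (- (2 * t + 1 / 2) * m\<^sup>2 - real ?n * (2 * t + 2) * m) + (2 * t + 1) * l\<^sup>2 =
          (m - P)\<^sup>2 / 2 + (2 * t + 1) * (1 / t)\<^sup>2"
        unfolding P_def by (simp only:)
      moreover have "(m - P)\<^sup>2 / 2 + (2 * t + 1) * (1 / t)\<^sup>2 \<ge> 0" using t by simp
      ultimately show ?thesis by linarith
    qed
    then have "exp (- (2 * t + 1) * l\<^sup>2) \<le> exp (P\<^sup>2 / 2) * exp (- (2 * t + 1 / 2) * m\<^sup>2 - real ?n * (2 * t + 2) * m)"
      unfolding exp_add[symmetric] by simp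
    also have "\<dots> \<le> exp (P\<^sup>2 / 2) * (fibre_density TYPE('n) t 1 1 m / c')"
      using c'(1) c'(2)[OF m] by (intro mult_left_mono) (auto simp: field_simps)
    finally have "c / a ^ (2 * ?n) * exp (- (2 * t + 1) * l\<^sup>2) \<le> (c + 1) / a ^ (2 * ?n) * (exp (P\<^sup>2 / 2) * (fibre_density TYPE('n) t 1 1 m / c'))"
      using a c(1) by (intro mult_mono divide_right_mono) auto
    with c(2)[OF a l] show "fibre_density TYPE('n) t a (1 / 2) l \<le> K / a ^ (2 * ?n) * fibre_density TYPE('n) t 1 1 (\<bar>l\<bar> + 1 / t)"
      unfolding K_def m_def[symmetric] by (simp add: mult_ac)
  qed
qed

text \<open>The constant must serve every \<open>k\<close> at once, because nothing is known about
  where the weight is concentrated.\<close>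

lemma fibre_norm_compare:
  assumes t: "t > 0"
  shows "\<exists>K>0. \<forall>a\<ge>1. \<forall>k :: 'n::finite heis.
    (\<integral>\<^sup>+ h. ennreal ((cmod (heat_transform t (heis_gauss a (1 / 2)) (heis_polar (h, k))))\<^sup>2) \<partial>lborel) \<le>
    ennreal (K / a ^ (2 * CARD('n))) * (\<integral>\<^sup>+ h. ennreal ((cmod (heat_transform t (heis_gauss 1 1) (heis_polar (h, k))))\<^sup>2) \<partial>lborel)"
proof -
  let ?n = "CARD('n)"
  obtain K where K: "K > 0" "\<And>a l. a \<ge> 1 \<Longrightarrow> l \<noteq> 0 \<Longrightarrow>
      fibre_density TYPE('n) t a (1 / 2) l \<le> K / a ^ (2 * ?n) * fibre_density TYPE('n) t 1 1 (\<bar>l\<bar> + 1 / t)"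
    using fibre_density_compare[OF t] by blast
  show ?thesis
  proof (intro exI[of _ "4 * K"] conjI allI impI)
    show "4 * K > 0" using K by simp
    fix a :: real and k :: "'n heis" assume a: "1 \<le> a"
    obtain y v \<eta> where k: "k = (y, v, \<eta>)" by (cases k)
    have a0: "a > 0" using a by simp
    define R where "R = y \<bullet> y + v \<bullet> v"
    have R0: "R \<ge> 0" by (simp add: R_def)
    define H where "H m = fibre_density TYPE('n) t 1 1 m * exp (2 * m * \<eta> + fibre_exponent t 1 m * R)" for m
    define \<kappa> where "\<kappa> = K / a ^ (2 * ?n)"
    have \<kappa>0: "\<kappa> \<ge> 0" using K a by (simp add: \<kappa>_def)
    have [measurable]: "H \<in> borel_measurable borel" unfolding H_def by measurable
    have dn: "fibre_density TYPE('n) t 1 1 m \<ge> 0" for m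
    proof (cases "m = 0")
      case True then show ?thesis by (simp add: fibre_density_def conv_rate_def hk_rate_def conv_amp_def hk_amp_def)
    next
      case False
      show ?thesis using conv_rate_bounds(1)[OF t _ False, of 1] by (simp add: fibre_density_def)
    qed
    have H0: "H m \<ge> 0" for m using dn by (simp add: H_def)
    \<comment> \<open>Only two of the four arguments are \<open>m\<close> and \<open>- m\<close>;
      which two depends on the sign of \<open>l\<close>. Keeping all four gives affine functions of
      \<open>l\<close> on the whole line, each with the same integral, and costs the factor
      \<open>4\<close>.\<close>
    have pw: "fibre_density TYPE('n) t a (1 / 2) l * exp (2 * l * \<eta> + fibre_exponent t a l * R) \<le>
       \<kappa> * (H (1 / t + 1 * l) + H (1 / t + (- 1) * l) + H (- (1 / t) + 1 * l) + H (- (1 / t) + (- 1) * l))" if l: "l \<noteq> 0" for l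
    proof -
      define m where "m = \<bar>l\<bar> + 1 / t"
      have m0: "m > 0" using t by (simp add: m_def add_nonneg_pos)
      \<comment> \<open>The chain passes through \<open>hk_rate\<close>, which does not involve
        \<open>a\<close>, and so connects the parameter \<open>a\<close> at \<open>l\<close> with
        the parameter \<open>1\<close> at \<open>m\<close>.\<close>
      have "fibre_exponent t a l \<le> 4 * hk_rate t l"
        unfolding fibre_exponent_def by (rule conv_rate_bounds(3)[OF t a0 l])
      also have "\<dots> \<le> m" unfolding m_def by (rule hk_rate_bounds(2)[OF t l])
      also have "m \<le> fibre_exponent t 1 m"
        unfolding fibre_exponent_def using conv_rate_bounds(4)[OF t _, of 1 m] m0 by simp
      finally have th: "fibre_exponent t a l * R \<le> fibre_exponent t 1 m * R"
        using R0 by (intro mult_right_mono) auto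
      have "l * \<eta> \<le> \<bar>l\<bar> * \<bar>\<eta>\<bar>" using abs_ge_self[of "l * \<eta>"] by (simp add: abs_mult)
      also have "\<dots> \<le> m * \<bar>\<eta>\<bar>" using t by (intro mult_right_mono) (auto simp: m_def)
      finally have "exp (2 * l * \<eta> + fibre_exponent t a l * R) \<le> exp (2 * (m * \<bar>\<eta>\<bar>) + fibre_exponent t 1 m * R)"
        using th by simp
      \<comment> \<open>The sign of \<open>\<eta>\<close> is arbitrary, so both frequencies
        \<open>m\<close> and \<open>- m\<close> are kept.\<close>
      also have "\<dots> \<le> exp (2 * m * \<eta> + fibre_exponent t 1 m * R) + exp (2 * (- m) * \<eta> + fibre_exponent t 1 m * R)"
        by (cases "\<eta> \<ge> 0") (simp_all add: mult_ac)
      finally have "fibre_density TYPE('n) t a (1 / 2) l * exp (2 * l * \<eta> + fibre_exponent t a l * R) \<le>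
         (\<kappa> * fibre_density TYPE('n) t 1 1 m) * (exp (2 * m * \<eta> + fibre_exponent t 1 m * R) + exp (2 * (- m) * \<eta> + fibre_exponent t 1 m * R))"
        using K(2)[OF a l, folded \<kappa>_def m_def] mult_nonneg_nonneg[OF \<kappa>0 dn[of m]] by (intro mult_mono) auto
      also have "\<dots> = \<kappa> * (H m + H (- m))"
        by (simp add: H_def algebra_simps)
      also have "\<dots> \<le> \<kappa> * (H (1 / t + 1 * l) + H (1 / t + (- 1) * l) + H (- (1 / t) + 1 * l) + H (- (1 / t) + (- 1) * l))"
      proof (intro mult_left_mono \<kappa>0)
        show "H m + H (- m) \<le> H (1 / t + 1 * l) + H (1 / t + (- 1) * l) + H (- (1 / t) + 1 * l) + H (- (1 / t) + (- 1) * l)"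
        proof (cases "l \<ge> 0")
          case True
          then have "m = 1 / t + 1 * l" "- m = - (1 / t) + (- 1) * l" by (auto simp: m_def)
          then have "H m = H (1 / t + 1 * l)" "H (- m) = H (- (1 / t) + (- 1) * l)" by (simp_all only:)
          then show ?thesis using H0[of "1 / t + (- 1) * l"] H0[of "- (1 / t) + 1 * l"] by linarith
        next
          case False
          then have "m = 1 / t + (- 1) * l" "- m = - (1 / t) + 1 * l" by (auto simp: m_def)
          then have "H m = H (1 / t + (- 1) * l)" "H (- m) = H (- (1 / t) + 1 * l)" by (simp_all only:)
          then show ?thesis using H0[of "1 / t + 1 * l"] H0[of "- (1 / t) + (- 1) * l"] by linarith
        qed
      qed
      finally show ?thesis .
    qed
    have sh: "(\<integral>\<^sup>+ l. ennreal (H (s + c * l)) \<partial>lborel) = (\<integral>\<^sup>+ l. ennreal (H l) \<partial>lborel)" if "\<bar>c\<bar> = 1" for s c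
    proof -
      have "(\<integral>\<^sup>+ l. ennreal (H l) \<partial>lborel) = ennreal \<bar>c\<bar> * (\<integral>\<^sup>+ l. ennreal (H (s + c * l)) \<partial>lborel)"
        using that by (intro nn_integral_real_affine) auto
      then show ?thesis using that by simp
    qed
    have "(\<integral>\<^sup>+ l. ennreal (fibre_density TYPE('n) t a (1 / 2) l * exp (2 * l * \<eta> + fibre_exponent t a l * R)) \<partial>lborel)
       \<le> (\<integral>\<^sup>+ l. ennreal \<kappa> * (ennreal (H (1 / t + 1 * l)) + ennreal (H (1 / t + (- 1) * l)) + ennreal (H (- (1 / t) + 1 * l)) + ennreal (H (- (1 / t) + (- 1) * l))) \<partial>lborel)"
    proof (rule nn_integral_mono_AE)
      have "ennreal (fibre_density TYPE('n) t a (1 / 2) l * exp (2 * l * \<eta> + fibre_exponent t a l * R)) \<le>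
        ennreal \<kappa> * (ennreal (H (1 / t + 1 * l)) + ennreal (H (1 / t + (- 1) * l)) + ennreal (H (- (1 / t) + 1 * l)) + ennreal (H (- (1 / t) + (- 1) * l)))"
        if "l \<noteq> 0" for l
        using ennreal_leI[OF pw[OF that]] H0 \<kappa>0 by (simp add: ennreal_mult ennreal_plus add_nonneg_nonneg del: ennreal_plus mult_1 mult_minus1)
           (simp add: ennreal_plus[symmetric] del: ennreal_plus)
      then show "AE l in lborel. ennreal (fibre_density TYPE('n) t a (1 / 2) l * exp (2 * l * \<eta> + fibre_exponent t a l * R)) \<le>
        ennreal \<kappa> * (ennreal (H (1 / t + 1 * l)) + ennreal (H (1 / t + (- 1) * l)) + ennreal (H (- (1 / t) + 1 * l)) + ennreal (H (- (1 / t) + (- 1) * l)))"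
        using AE_lborel_singleton[of "0::real"] by (auto elim: eventually_mono)
    qed
    also have "\<dots> = ennreal \<kappa> * ((\<integral>\<^sup>+ l. ennreal (H (1 / t + 1 * l)) \<partial>lborel) + (\<integral>\<^sup>+ l. ennreal (H (1 / t + (- 1) * l)) \<partial>lborel) +
        (\<integral>\<^sup>+ l. ennreal (H (- (1 / t) + 1 * l)) \<partial>lborel) + (\<integral>\<^sup>+ l. ennreal (H (- (1 / t) + (- 1) * l)) \<partial>lborel))"
      by (subst nn_integral_cmult, measurable) (subst nn_integral_add, measurable, subst nn_integral_add, measurable, subst nn_integral_add, measurable)
    also have "\<dots> = ennreal \<kappa> * (4 * (\<integral>\<^sup>+ l. ennreal (H l) \<partial>lborel))"
    proof -
      have "J + J + J + J = 4 * J" for J :: ennreal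
      proof -
        have "(4::ennreal) = 1 + 1 + 1 + 1" by simp
        then show ?thesis by (simp only: distrib_right mult_1)
      qed
      then show ?thesis
        unfolding sh[of 1, simplified abs_one, OF refl] sh[of "- 1", simplified abs_neg_one, OF refl] by (simp only:)
    qed
    also have "\<dots> = ennreal (4 * K / a ^ (2 * ?n)) * (\<integral>\<^sup>+ l. ennreal (H l) \<partial>lborel)"
    proof -
      have "ennreal (4 * K / a ^ (2 * ?n)) = ennreal \<kappa> * 4"
        using \<kappa>0 ennreal_mult[of \<kappa> 4] by (simp add: \<kappa>_def mult_ac)
      then show ?thesis by (simp add: mult_ac)
    qed
    finally have main: "(\<integral>\<^sup>+ l. ennreal (fibre_density TYPE('n) t a (1 / 2) l * exp (2 * l * \<eta> + fibre_exponent t a l * R)) \<partial>lborel)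
       \<le> ennreal (4 * K / a ^ (2 * ?n)) * (\<integral>\<^sup>+ l. ennreal (H l) \<partial>lborel)" .
    have half: "(1 / 2 :: real) > 0" and one: "(1 :: real) > 0" by auto
    show "(\<integral>\<^sup>+ h. ennreal ((cmod (heat_transform t (heis_gauss a (1 / 2)) (heis_polar (h, k))))\<^sup>2) \<partial>lborel) \<le>
      ennreal (4 * K / a ^ (2 * ?n)) * (\<integral>\<^sup>+ h. ennreal ((cmod (heat_transform t (heis_gauss 1 1) (heis_polar (h, k))))\<^sup>2) \<partial>lborel)"
      unfolding k nn_integral_heat_transform_fibre[OF t a0 half] nn_integral_heat_transform_fibre[OF t one one] R_def[symmetric] H_def[symmetric]
      using mult_left_mono[OF main, of "ennreal (2 * pi * ((4 * pi) powi (- int CARD('n)))\<^sup>2)"]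
      by (simp add: mult_ac)
  qed
qed

section \<open>Contradiction from concentrating Gaussians\<close>

theorem theorem6p2:
  fixes t :: real
  assumes "t > 0"
  shows "\<not> (\<exists>W :: 'n::finite heisC \<Rightarrow> real.
            W \<in> borel_measurable lebesgue \<and> (\<forall>g. W g \<ge> 0) \<and>
            (\<forall>h g. W (heisC_mult (heis_emb h) g) = W g) \<and>
            (\<forall>f \<in> (L2_heis :: ('n heis \<Rightarrow> complex) set).
               (\<integral>\<^sup>+ h. ennreal ((cmod (f h))\<^sup>2) \<partial>lebesgue) =
               (\<integral>\<^sup>+ g. ennreal ((cmod (heat_transform t f g))\<^sup>2 * W g) \<partial>lebesgue)))"
proof
  let ?n = "CARD('n)"
  assume "\<exists>W :: 'n::finite heisC \<Rightarrow> real.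
            W \<in> borel_measurable lebesgue \<and> (\<forall>g. W g \<ge> 0) \<and>
            (\<forall>h g. W (heisC_mult (heis_emb h) g) = W g) \<and>
            (\<forall>f \<in> (L2_heis :: ('n heis \<Rightarrow> complex) set).
               (\<integral>\<^sup>+ h. ennreal ((cmod (f h))\<^sup>2) \<partial>lebesgue) =
               (\<integral>\<^sup>+ g. ennreal ((cmod (heat_transform t f g))\<^sup>2 * W g) \<partial>lebesgue))"
  then obtain W :: "'n heisC \<Rightarrow> real" where W: "W \<in> borel_measurable lebesgue" "\<And>g. W g \<ge> 0"
      "\<And>h g. W (heisC_mult (heis_emb h) g) = W g"
    and iso: "\<And>f :: 'n heis \<Rightarrow> complex. f \<in> L2_heis \<Longrightarrow> (\<integral>\<^sup>+ h. ennreal ((cmod (f h))\<^sup>2) \<partial>lebesgue) =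
               (\<integral>\<^sup>+ g. ennreal ((cmod (heat_transform t f g))\<^sup>2 * W g) \<partial>lebesgue)"
    by blast
  obtain W0 :: "'n heis \<Rightarrow> ennreal" where W0[measurable]: "W0 \<in> borel_measurable borel" and
    red: "\<And>F. F \<in> borel_measurable borel \<Longrightarrow> (\<integral>\<^sup>+ g. F g * ennreal (W g) \<partial>lebesgue) =
        (\<integral>\<^sup>+ k. (\<integral>\<^sup>+ h. F (heis_polar (h, k)) \<partial>lborel) * W0 k \<partial>lborel)"
    using invariant_weight_reduction[OF W(1,3)] by blast
  define I where "I a b k = (\<integral>\<^sup>+ h. ennreal ((cmod (heat_transform t (heis_gauss a b) (heis_polar (h, k :: 'n heis))))\<^sup>2) \<partial>lborel)" for a b k
  have norm: "ennreal ((pi / (2 * a)) ^ ?n * sqrt (pi / (2 * b))) = (\<integral>\<^sup>+ k. I a b k * W0 k \<partial>lborel)" if "a > 0" "b > 0" for a b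
  proof -
    have "(\<lambda>g :: 'n heisC. ennreal ((cmod (heat_transform t (heis_gauss a b) g))\<^sup>2)) \<in> borel_measurable borel"
      using borel_measurable_heat_transform_heis_gauss[OF assms that, where ?'n = 'n] by measurable
    from red[OF this] show ?thesis
      using iso[OF heis_gauss_L2(1)[OF that]] W(2)
      unfolding heis_gauss_L2(2)[OF that] I_def by (simp add: ennreal_mult)
  qed
  obtain K where K: "K > 0" "\<And>a k. a \<ge> 1 \<Longrightarrow> I a (1 / 2) k \<le> ennreal (K / a ^ (2 * ?n)) * I 1 1 k"
    using fibre_norm_compare[OF assms, where ?'n = 'n] unfolding I_def by blast
  have Im: "I 1 1 \<in> borel_measurable borel"
  proof -
    have [measurable]: "heat_transform t (heis_gauss 1 1) \<in> borel_measurable (borel :: 'n heisC measure)"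
      by (rule borel_measurable_heat_transform_heis_gauss[OF assms]) auto
    have [measurable]: "heis_polar \<in> borel_measurable (borel \<Otimes>\<^sub>M (borel :: 'n heis measure))"
      unfolding borel_prod by measurable
    have "(\<lambda>k. \<integral>\<^sup>+ h. ennreal ((cmod (heat_transform t (heis_gauss 1 1) (heis_polar (h, k :: 'n heis))))\<^sup>2) \<partial>lborel) \<in> borel_measurable borel"
      by measurable
    then show ?thesis unfolding I_def .
  qed
  note [measurable] = Im
  have key: "a ^ ?n \<le> K" if a: "a \<ge> 1" for a
  proof -
    have "ennreal ((pi / (2 * a)) ^ ?n * sqrt (pi / (2 * (1 / 2)))) = (\<integral>\<^sup>+ k. I a (1 / 2) k * W0 k \<partial>lborel)"
      using a by (intro norm) auto
    \<comment> \<open>Non-negativity of the weight enters here: the fibrewise inequality is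
      multiplied by \<open>W0 k\<close> and integrated.\<close>
    also have "\<dots> \<le> (\<integral>\<^sup>+ k. ennreal (K / a ^ (2 * ?n)) * (I 1 1 k * W0 k) \<partial>lborel)"
      using K(2)[OF a] by (intro nn_integral_mono) (simp add: mult.assoc[symmetric] mult_right_mono)
    also have "\<dots> = ennreal (K / a ^ (2 * ?n)) * (\<integral>\<^sup>+ k. I 1 1 k * W0 k \<partial>lborel)"
      by (intro nn_integral_cmult) measurable
    \<comment> \<open>The isometry also evaluates the majorant, and this is what makes it
      finite.\<close>
    also have "\<dots> = ennreal (K / a ^ (2 * ?n)) * ennreal ((pi / (2 * 1)) ^ ?n * sqrt (pi / (2 * 1)))"
      using norm[of 1 1] by simp
    also have "\<dots> = ennreal (K / a ^ (2 * ?n) * ((pi / 2) ^ ?n * sqrt (pi / 2)))"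
      using K(1) a by (subst ennreal_mult[symmetric]) auto
    finally have "(pi / (2 * a)) ^ ?n * sqrt pi \<le> K / a ^ (2 * ?n) * ((pi / 2) ^ ?n * sqrt (pi / 2))"
      using K(1) a by (subst (asm) ennreal_le_iff) auto
    \<comment> \<open>Enlarging \<open>sqrt (pi / 2)\<close> to \<open>sqrt pi\<close> gives both
      sides the common factor \<open>p\<close>.\<close>
    also have "\<dots> \<le> K / a ^ (2 * ?n) * ((pi / 2) ^ ?n * sqrt pi)"
      using K(1) a by (intro mult_left_mono) auto
    finally have le: "(pi / (2 * a)) ^ ?n * sqrt pi \<le> K / a ^ (2 * ?n) * ((pi / 2) ^ ?n * sqrt pi)" .
    define p where "p = (pi / 2) ^ ?n * sqrt pi"
    have p: "p > 0" by (simp add: p_def)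
    define A where "A = a ^ ?n"
    have A: "A > 0" using a by (simp add: A_def)
    have "(pi / (2 * a)) ^ ?n * sqrt pi = p / A"
      unfolding p_def A_def power_divide power_mult_distrib by simp
    moreover have "a ^ (2 * ?n) = A * A" by (simp add: A_def mult_2 power_add)
    ultimately have "p / A \<le> K / (A * A) * p" using le by (simp add: p_def)
    then have "A \<le> K" using A p by (simp add: field_simps)
    then show ?thesis by (simp add: A_def)
  qed
  \<comment> \<open>The choice \<open>a = K + 1\<close> breaks the bound, as the exponent
    \<open>n\<close> is at least \<open>1\<close>.\<close>
  have "K + 1 \<le> (K + 1) ^ ?n"
    using K(1) by (intro self_le_power) auto
  also have "\<dots> \<le> K" using K(1) by (intro key) auto
  finally show False by simp
qed

end
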